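(* Let $\alpha\in(0,1)$, let $m, M_0, M_1>0$ and let $0<p\le P$. There exists a constant $K$, depending only on $\alpha$, $m$, $M_1$, $p$ and $P$, such that the following holds. Let $\zeta_o\in\mathbb{C}$ and, for $j=1,2$, let $\Omega_j\subseteq\mathbb{C}$ be a bounded, simply connected open set with boundary of class $C^{1,\alpha}$, with $\zeta_o\in\Omega_j$ and perimeter $L_j$ satisfying $p\le L_j\le P$; let $\zeta_j\in\partial\Omega_j$ and let $f_j\in C^{1,\alpha}(\overline D,\mathbb{C})$ be the one-to-one function, analytic in $D$, with $f_j(D)=\Omega_j$, $f_j(0)=\zeta_o$, $f_j(1)=\zeta_j$. Put $\varphi_j=\mathcal{T}(f_j)$, $L=\frac{L_1+L_2}{2}$ and $$\hat\varphi_j(s)=\varphi_j\left(\frac{L_j}{L}s\right),\quad s\in[0,L]\qquad(j=1,2).$$ If $\varphi_j\in\mathscr{G}_1^{L_j}$ for $j=1,2$, then, up to rotations of the domains around $\zeta_o$ (that is, after replacing $f_1$ by $\zeta_o+\lambda(f_1-\zeta_o)$ for a suitable $\lambda\in\mathbb{C}$ with $|\lambda|=1$), $$\Vert f_1-f_2\Vert_{1,0,\partial D}\le K\left\{\left(\frac{|L_1-L_2|}{P}+\frac{\Vert\hat\varphi_1-\hat\varphi_2\Vert_{\infty,[0,L]}}{M_1}\right)^{\alpha}+\Vert\hat\varphi_1'-\hat\varphi_2'\Vert_{\infty,[0,L]}\right\}.$$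
   Context: $D$ is the open unit disk in $\mathbb{C}$. Existence and uniqueness of $f_j$ follow from the Riemann mapping theorem and Kellogg's theorem. For $f=f_j$, $\Omega=\Omega_j$, let $u$ be the solution of $-\Delta u=\delta_{\zeta_o}$ in $\Omega$, $u=0$ on $\partial\Omega$. $\mathcal{T}(f)$ denotes the interior normal derivative of $u$ on $\partial\Omega$ as a function of the arclength $s\in[0,|\partial\Omega|]$, measured counterclockwise from $f(1)$, extended $|\partial\Omega|$-periodically to $\mathbb{R}$. Parametrically, $s=\int_0^\theta|f'(e^{it})|\,dt$ and $\mathcal{T}(f)(s)=\frac{1}{2\pi|f'(e^{i\theta})|}$, $\theta\in[0,2\pi]$. For a function $\varphi$ on an interval $I$: $\Vert\varphi\Vert_{\infty,I}=\sup_I|\varphi|$, $[\varphi]_{k,\alpha,I}=\sup_{x\ne y\in I}\frac{|\varphi^{(k)}(x)-\varphi^{(k)}(y)|}{|x-y|^\alpha}$, $\Vert\varphi\Vert_{k,\alpha,I}=\sum_{j=0}^k\Vert\varphi^{(j)}\Vert_{\infty,I}+[\varphi]_{k,\alpha,I}$. For $g\in C^{1,\alpha}(\overline D,\mathbb{C})$ analytic in $D$, $\Vert g\Vert_{1,0,\partial D}=\sup_{\partial D}|g|+\sup_{\partial D}|g'|$. For $\ell>0$, $\mathscr{G}_0^{\ell}$ is the set of $\ell$-periodic $\varphi\in C^{0,\alpha}(\mathbb{R})$ with $\varphi\ge m$ and $\Vert\varphi\Vert_{0,\alpha,[0,\ell]}\le M_0$; $\mathscr{G}_1^{\ell}$ is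 the set of $\varphi\in\mathscr{G}_0^{\ell}\cap C^{1,\alpha}(\mathbb{R})$ with $\Vert\varphi\Vert_{1,\alpha,[0,\ell]}\le M_1$. *)

theory Defs
  imports "HOL-Complex_Analysis.Complex_Analysis"
begin

section \<open>Hoelder spaces and norms on the real line\<close>

definition sup_norm :: "real set \<Rightarrow> (real \<Rightarrow> real) \<Rightarrow> real" where
  "sup_norm I \<phi> = (SUP x\<in>I. \<bar>\<phi> x\<bar>)"

definition holder_seminorm :: "nat \<Rightarrow> real \<Rightarrow> real set \<Rightarrow> (real \<Rightarrow> real) \<Rightarrow> real" where
  "holder_seminorm k \<alpha> I \<phi> =
     (SUP (x, y)\<in>{(x, y). x \<in> I \<and> y \<in> I \<and> x \<noteq> y}.
        \<bar>(deriv ^^ k) \<phi> x - (deriv ^^ k) \<phi> y\<bar> / \<bar>x - y\<bar> powr \<alpha>)"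

definition holder_norm :: "nat \<Rightarrow> real \<Rightarrow> real set \<Rightarrow> (real \<Rightarrow> real) \<Rightarrow> real" where
  "holder_norm k \<alpha> I \<phi> = (\<Sum>j\<le>k. sup_norm I ((deriv ^^ j) \<phi>)) + holder_seminorm k \<alpha> I \<phi>"

definition holder_continuous_on :: "real \<Rightarrow> 'a::metric_space set \<Rightarrow> ('a \<Rightarrow> 'b::metric_space) \<Rightarrow> bool" where
  "holder_continuous_on \<alpha> S g \<longleftrightarrow> (\<exists>C. \<forall>x\<in>S. \<forall>y\<in>S. dist (g x) (g y) \<le> C * dist x y powr \<alpha>)"

text \<open>
  \<open>C_holder k \<alpha>\<close> is used for periodic functions only, for which boundedness of the derivatives up
  to order \<open>k\<close> is automatic.  For its members all suprema occurring in \<open>holder_norm k \<alpha> {0..l}\<close> are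
  finite, so that the real-valued \<open>SUP\<close> is the true supremum.
\<close>
definition C_holder :: "nat \<Rightarrow> real \<Rightarrow> (real \<Rightarrow> real) set" where
  "C_holder k \<alpha> = {\<phi>. (\<forall>j<k. \<forall>x. (deriv ^^ j) \<phi> differentiable (at x)) \<and>
                       holder_continuous_on \<alpha> UNIV ((deriv ^^ k) \<phi>)}"

definition G0 :: "real \<Rightarrow> real \<Rightarrow> real \<Rightarrow> real \<Rightarrow> (real \<Rightarrow> real) set" where
  "G0 \<alpha> m M\<^sub>0 l = {\<phi>\<in>C_holder 0 \<alpha>. (\<forall>s. \<phi> (s + l) = \<phi> s) \<and> (\<forall>s. \<phi> s \<ge> m) \<and>
                        holder_norm 0 \<alpha> {0..l} \<phi> \<le> M\<^sub>0}"

definition G1 :: "real \<Rightarrow> real \<Rightarrow> real \<Rightarrow> real \<Rightarrow> real \<Rightarrow> (real \<Rightarrow> real) set" where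
  "G1 \<alpha> m M\<^sub>0 M\<^sub>1 l = {\<phi>\<in>G0 \<alpha> m M\<^sub>0 l \<inter> C_holder 1 \<alpha>. holder_norm 1 \<alpha> {0..l} \<phi> \<le> M\<^sub>1}"


section \<open>Analytic functions of class $C^{1,\alpha}$ on the closed unit disc\<close>

text \<open>
  For \<open>g\<close> analytic in the open disc and \<open>C\<^sup>1\<close> up to the boundary, the continuous extension of
  the complex derivative to the closed disc is the derivative relative to the closed disc.
\<close>
definition cdisc_deriv :: "(complex \<Rightarrow> complex) \<Rightarrow> complex \<Rightarrow> complex" where
  "cdisc_deriv g z = (THE d. (g has_field_derivative d) (at z within cball 0 1))"

definition analytic_C1_holder :: "real \<Rightarrow> (complex \<Rightarrow> complex) \<Rightarrow> bool" where
  "analytic_C1_holder \<alpha> g \<longleftrightarrow>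
     g holomorphic_on ball 0 1 \<and>
     (\<exists>g'. (\<forall>z\<in>cball 0 1. (g has_field_derivative g' z) (at z within cball 0 1)) \<and>
           holder_continuous_on \<alpha> (cball 0 1) g')"

definition C1_norm_circle :: "(complex \<Rightarrow> complex) \<Rightarrow> real" where
  "C1_norm_circle g = (SUP z\<in>sphere 0 1. cmod (g z)) + (SUP z\<in>sphere 0 1. cmod (cdisc_deriv g z))"


section \<open>Domains with boundary of class $C^{1,\alpha}$\<close>

text \<open>
  Near each boundary point \<open>\<zeta>\<close>, in Cartesian coordinates \<open>x + iy = (z - \<zeta>) / \<tau>\<close> centred at \<open>\<zeta>\<close>
  and rotated by a unit vector \<open>\<tau>\<close>, the set lies strictly above the graph \<open>y = h(x)\<close> of a
  $C^{1,\alpha}$ function \<open>h\<close>.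
\<close>
definition C1_holder_boundary :: "real \<Rightarrow> complex set \<Rightarrow> bool" where
  "C1_holder_boundary \<alpha> \<Omega> \<longleftrightarrow>
     (\<forall>\<zeta>\<in>frontier \<Omega>. \<exists>\<tau> r (h :: real \<Rightarrow> real) h'.
        cmod \<tau> = 1 \<and> r > 0 \<and>
        (\<forall>x\<in>{-r..r}. (h has_real_derivative h' x) (at x)) \<and> holder_continuous_on \<alpha> {-r..r} h' \<and>
        (\<forall>z\<in>ball \<zeta> r. z \<in> \<Omega> \<longleftrightarrow> Im ((z - \<zeta>) / \<tau>) > h (Re ((z - \<zeta>) / \<tau>))))"

definition C1_holder_domain :: "real \<Rightarrow> complex set \<Rightarrow> bool" where
  "C1_holder_domain \<alpha> \<Omega> \<longleftrightarrow>
     open \<Omega> \<and> bounded \<Omega> \<and> simply_connected \<Omega> \<and> C1_holder_boundary \<alpha> \<Omega>"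

text \<open>
  The conformal parametrization is one-to-one on the closed disc, which is its domain as a member
  of $C^{1,\alpha}(\overline D, \mathbb{C})$.  Values of \<open>f\<close> outside the closed disc are irrelevant.
\<close>
definition conformal_param ::
    "real \<Rightarrow> complex set \<Rightarrow> complex \<Rightarrow> complex \<Rightarrow> (complex \<Rightarrow> complex) \<Rightarrow> bool" where
  "conformal_param \<alpha> \<Omega> \<zeta>\<^sub>o \<zeta> f \<longleftrightarrow>
     analytic_C1_holder \<alpha> f \<and> inj_on f (cball 0 1) \<and> f ` ball 0 1 = \<Omega> \<and> f 0 = \<zeta>\<^sub>o \<and> f 1 = \<zeta>"


section \<open>The Dirichlet problem with a point source\<close>

text \<open>Classical harmonicity: \<open>h\<close> is twice continuously differentiable, with vanishing Laplacian.\<close>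
definition harmonic_on :: "(complex \<Rightarrow> real) \<Rightarrow> complex set \<Rightarrow> bool" where
  "harmonic_on h S \<longleftrightarrow>
     (\<exists>hx hy hxx hxy hyx hyy.
        (\<forall>z\<in>S. (h has_derivative (\<lambda>w. hx z * Re w + hy z * Im w)) (at z) \<and>
                (hx has_derivative (\<lambda>w. hxx z * Re w + hxy z * Im w)) (at z) \<and>
                (hy has_derivative (\<lambda>w. hyx z * Re w + hyy z * Im w)) (at z) \<and>
                hxx z + hyy z = 0) \<and>
        continuous_on S hxx \<and> continuous_on S hxy \<and> continuous_on S hyx \<and> continuous_on S hyy)"

text \<open>
  \<open>u\<close> solves \<open>-\<Delta>u = \<delta>\<close> in \<open>\<Omega>\<close> (Dirac mass at \<open>\<zeta>\<^sub>o\<close>), \<open>u = 0\<close> on the boundary.  The equation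
  means that \<open>u\<close> is the fundamental solution $-\frac{1}{2\pi}\ln|z-\zeta_o|$ of \<open>-\<Delta>\<close> plus a function
  harmonic in all of \<open>\<Omega>\<close>.
\<close>
definition dirichlet_point_source :: "complex set \<Rightarrow> complex \<Rightarrow> (complex \<Rightarrow> real) \<Rightarrow> bool" where
  "dirichlet_point_source \<Omega> \<zeta>\<^sub>o u \<longleftrightarrow>
     (\<exists>h. harmonic_on h \<Omega> \<and> (\<forall>z\<in>\<Omega> - {\<zeta>\<^sub>o}. u z = - ln (cmod (z - \<zeta>\<^sub>o)) / (2 * pi) + h z)) \<and>
     continuous_on (closure \<Omega> - {\<zeta>\<^sub>o}) u \<and> (\<forall>z\<in>frontier \<Omega>. u z = 0)"

text \<open>The solution is unique on the closure of \<open>\<Omega>\<close> minus \<open>\<zeta>\<^sub>o\<close>; other values are never used.\<close>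
definition point_source_solution :: "complex set \<Rightarrow> complex \<Rightarrow> complex \<Rightarrow> real" where
  "point_source_solution \<Omega> \<zeta>\<^sub>o = (SOME u. dirichlet_point_source \<Omega> \<zeta>\<^sub>o u)"


section \<open>The operator $\mathcal{T}$\<close>

text \<open>The counterclockwise boundary curve of \<open>f ` ball 0 1\<close>, its arclength from \<open>f 1\<close>, its total length.\<close>
definition bdry_curve :: "(complex \<Rightarrow> complex) \<Rightarrow> real \<Rightarrow> complex" where
  "bdry_curve f \<theta> = f (cis \<theta>)"

definition bdry_arclength :: "(complex \<Rightarrow> complex) \<Rightarrow> real \<Rightarrow> real" where
  "bdry_arclength f \<theta> = integral {0..\<theta>} (\<lambda>t. norm (vector_derivative (bdry_curve f) (at t)))"

definition perimeter :: "(complex \<Rightarrow> complex) \<Rightarrow> real" where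
  "perimeter f = bdry_arclength f (2 * pi)"

text \<open>
  As the boundary curve runs counterclockwise, the interior unit normal is the unit tangent rotated
  by \<open>\<pi>/2\<close>.
\<close>
definition interior_normal :: "(complex \<Rightarrow> complex) \<Rightarrow> real \<Rightarrow> complex" where
  "interior_normal f \<theta> = \<i> * sgn (vector_derivative (bdry_curve f) (at \<theta>))"

definition directional_deriv :: "(complex \<Rightarrow> real) \<Rightarrow> complex \<Rightarrow> complex \<Rightarrow> real" where
  "directional_deriv u \<nu> z = Lim (at_right 0) (\<lambda>t::real. (u (z + of_real t * \<nu>) - u z) / t)"

text \<open>
  \<open>T_op f\<close> is the interior normal derivative of the solution \<open>u\<close> on the boundary of
  \<open>\<Omega> = f ` ball 0 1\<close> with source at \<open>f 0\<close>, as a function of the arclength, extended periodically.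
\<close>
definition T_op :: "(complex \<Rightarrow> complex) \<Rightarrow> real \<Rightarrow> real" where
  "T_op f = (THE \<phi>.
     (\<forall>s. \<phi> (s + perimeter f) = \<phi> s) \<and>
     (\<forall>\<theta>\<in>{0..2 * pi}. \<phi> (bdry_arclength f \<theta>) =
        directional_deriv (point_source_solution (f ` ball 0 1) (f 0))
          (interior_normal f \<theta>) (bdry_curve f \<theta>)))"

end

theory Submission
  imports Defs
begin

text \<open>
  On the boundary the normal derivative of the Green function is \<open>1 / (2 \<pi> \<bar>f'\<bar>)\<close>, so \<open>\<phi> = T(f)\<close> turns the
  arclength into a solution of the autonomous equation \<open>2 \<pi> \<phi>(s) s' = 1\<close>. Comparing the two rescaled
  equations bounds \<open>v = ln \<bar>f\<^sub>1'\<bar> - ln \<bar>f\<^sub>2'\<bar>\<close> and its \<open>\<theta>\<close>-derivative on the circle by a multiple of the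
  right-hand side. After the rotation, \<open>v\<close> is the real part of the holomorphic function
  \<open>log (c f\<^sub>1' / f\<^sub>2')\<close>, real at 0, and the conjugate of a function with Lipschitz constant \<open>\<Lambda>\<close> is
  bounded by a multiple of \<open>\<Lambda>\<close>; so \<open>c f\<^sub>1' - f\<^sub>2'\<close> is controlled on the closed disc, and integrating
  from 0 controls \<open>c (f\<^sub>1 - \<zeta>\<^sub>o) - (f\<^sub>2 - \<zeta>\<^sub>o)\<close>.

  No boundary regularity theory is needed for \<open>f' \<noteq> 0\<close>: where \<open>f'\<close> vanishes, the tangent and hence
  \<open>interior_normal\<close> is the zero vector, the directional derivative is 0, and \<open>\<phi> \<ge> m > 0\<close> excludes this.
\<close>

section \<open>Conjugate functions of Lipschitz functions\<close>

text \<open>Conjugation is unbounded on continuous functions, so smallness of \<open>v\<close> alone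
  would not control the argument of the quotient of the derivatives. This forces an estimate of the
  angular derivative of \<open>v\<close>, and with it of the derivatives of the two profiles. Since
  the argument is wanted in the sup norm only, a Lipschitz bound on \<open>v\<close> is enough.

  The exponent \<alpha> has one source. At equal angle the two normalized arclengths differ by a
  multiple of the bracket \<eta> that carries the exponent, and the derivative of a profile is only
  Hoelder continuous, so evaluating it at the two points costs \<open>\<eta> powr \<alpha>\<close>.
  Errors linear in \<eta> are absorbed into this power because \<eta> is bounded a priori.

  The rotation supplies what moduli cannot determine: the constant of integration of the conjugate.
  Returning from the logarithm to the quotient costs an exponential of the error, harmless because
  the error itself is bounded in terms of the given constants.\<close>

lemma norm_exp_minus_one_le: "cmod (exp w - 1) \<le> cmod w * exp (cmod w)"
proof -
  have "cmod (exp w - exp 0) \<le> exp (cmod w) * cmod (w - 0)"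
  proof (rule field_differentiable_bound[of "cball 0 (cmod w)" exp exp])
    show "cmod (exp z) \<le> exp (cmod w)" if "z \<in> cball 0 (cmod w)" for z
      using that norm_exp[of z] by (auto intro: order_trans)
  qed (auto intro: DERIV_exp has_field_derivative_at_within)
  then show ?thesis by (simp add: mult.commute)
qed

text \<open>The bound on the real part confines the modulus of \<open>exp (F / \<Lambda>)\<close>
  between \<open>exp (- 1)\<close> and \<open>exp 1\<close>. The Cauchy inequality on the disc of
  radius \<open>(1 - \<bar>z\<bar>) / 2\<close> uses the upper bound and the division by
  \<open>H z\<close> the lower one, which accounts for \<open>2 * exp 2\<close>.\<close>

lemma norm_deriv_le_if_Re_bounded:
  assumes hol: "F holomorphic_on ball 0 1" and "\<Lambda> > 0"
    and re: "\<And>z. z \<in> ball 0 1 \<Longrightarrow> \<bar>Re (F z)\<bar> \<le> \<Lambda>" and z: "z \<in> ball 0 1"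
  shows "cmod (deriv F z) \<le> 2 * exp 2 * \<Lambda> / (1 - cmod z)"
proof -
  define H where "H w = exp (F w / \<Lambda>)" for w
  define r where "r = (1 - cmod z) / 2"
  have r: "r > 0" using z by (simp add: r_def)
  have sub: "cball z r \<subseteq> ball 0 1"
  proof
    fix w assume "w \<in> cball z r"
    then have "cmod (w - z) \<le> (1 - cmod z) / 2" by (simp add: r_def dist_norm norm_minus_commute)
    then have "cmod w < 1" using norm_triangle_sub[of w z] z by (auto simp: field_simps)
    then show "w \<in> ball 0 1" by simp
  qed
  have holH: "H holomorphic_on ball 0 1"
    unfolding H_def using hol \<open>\<Lambda> > 0\<close> by (intro holomorphic_intros) auto
  have norm_H: "cmod (H w) = exp (Re (F w) / \<Lambda>)" for w
    by (simp add: H_def)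
  have le: "cmod (H w) \<le> exp 1" and ge: "exp (- 1) \<le> cmod (H w)" if "w \<in> ball 0 1" for w
    using re[OF that] \<open>\<Lambda> > 0\<close> by (simp_all add: norm_H field_simps abs_le_iff)
  have "cmod ((deriv ^^ 1) H z) \<le> fact 1 * exp 1 / r ^ 1"
  proof (rule Cauchy_inequality)
    show "H holomorphic_on ball z r" "continuous_on (cball z r) H"
      using sub ball_subset_cball[of z r]
      by (intro holomorphic_on_subset[OF holH] continuous_on_subset[OF holomorphic_on_imp_continuous_on[OF holH]]; blast)+
    show "cmod (H w) \<le> exp 1" if "cmod (z - w) = r" for w
      using that sub by (intro le) (auto simp: dist_norm subset_iff)
  qed (use r in auto)
  then have H': "cmod (deriv H z) \<le> exp 1 / r" by simp
  have "(F has_field_derivative deriv F z) (at z)"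
    using hol z holomorphic_derivI open_ball by blast
  then have "(H has_field_derivative (H z * (deriv F z / \<Lambda>))) (at z)"
    unfolding H_def by (rule DERIV_chain2[OF DERIV_exp DERIV_cdivide])
  then have "deriv H z = H z * (deriv F z / \<Lambda>)" by (rule DERIV_imp_deriv)
  then have "cmod (deriv H z) = cmod (H z) * (cmod (deriv F z) / \<Lambda>)"
    using \<open>\<Lambda> > 0\<close> by (simp add: norm_mult norm_divide)
  then have "exp (- 1) * (cmod (deriv F z) / \<Lambda>) \<le> exp 1 / r"
    using H' ge[OF z] \<open>\<Lambda> > 0\<close> mult_right_mono[of "exp (- 1)" "cmod (H z)" "cmod (deriv F z) / \<Lambda>"]
    by simp
  then have "exp 1 * (exp (- 1) * (cmod (deriv F z) / \<Lambda>)) \<le> exp 1 * (exp 1 / r)"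
    by (intro mult_left_mono) auto
  then have "cmod (deriv F z) / \<Lambda> \<le> exp 2 / r"
    by (simp flip: exp_add mult.assoc)
  then show ?thesis
    using \<open>\<Lambda> > 0\<close> r by (simp add: r_def field_simps)
qed

lemma norm_diff_le_primitive:
  fixes g :: "real \<Rightarrow> complex"
  assumes "0 \<le> b" and cont: "continuous_on {0..b} g" "continuous_on {0..b} \<phi>"
    and g: "\<And>x. 0 < x \<Longrightarrow> x < b \<Longrightarrow> (g has_vector_derivative g' x) (at x)"
    and \<phi>: "\<And>x. 0 < x \<Longrightarrow> x < b \<Longrightarrow> (\<phi> has_vector_derivative \<phi>' x) (at x)"
    and le: "\<And>x. 0 < x \<Longrightarrow> x < b \<Longrightarrow> cmod (g' x) \<le> \<phi>' x"
  shows "cmod (g b - g 0) \<le> \<phi> b - \<phi> 0"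
proof (cases "b = 0")
  case False
  then show ?thesis using assms
    by (intro differentiable_bound_general[of 0 b g \<phi> g' \<phi>'])  auto
qed simp

lemma radial_vector_derivative:
  assumes "F holomorphic_on ball 0 1" "\<bar>x\<bar> < 1" "cmod u = 1"
  shows "((\<lambda>r. F (of_real r * u)) has_vector_derivative u * deriv F (of_real x * u)) (at x)"
proof -
  have "(F has_field_derivative deriv F (of_real x * u)) (at (of_real x * u))"
    using assms by (intro holomorphic_derivI[of _ "ball 0 1"]) (auto simp: norm_mult)
  moreover have "((\<lambda>r. of_real r * u) has_vector_derivative u) (at x)"
    by (auto intro!: derivative_eq_intros)
  ultimately show ?thesis
    using field_vector_diff_chain_at[of "\<lambda>r. of_real r * u" u x F] by (simp add: o_def)
qed

text \<open>
  For \<open>F z = \<i> z G'(z)\<close> the derivative bound integrates to \<open>\<bar>G'\<bar> \<le> C (1 - r)\<^bsup>-1/2\<^esup>\<close>, which is integrable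
  along radii.
\<close>
lemma norm_diff_le_if_angular_derivative_bounded:
  assumes hol: "G holomorphic_on ball 0 1" and "\<Lambda> > 0"
    and re: "\<And>z. z \<in> ball 0 1 \<Longrightarrow> \<bar>Re (\<i> * z * deriv G z)\<bar> \<le> \<Lambda>" and z: "z \<in> ball 0 1"
  shows "cmod (G z - G 0) \<le> 8 * exp 2 * \<Lambda>"
proof (cases "z = 0")
  case True then show ?thesis using \<open>\<Lambda> > 0\<close> by simp
next
  case False
  define u where "u = z / cmod z"
  define R where "R = cmod z"
  have u: "cmod u = 1" "z = of_real R * u" and R: "0 < R" "R < 1"
    using False z by (auto simp: u_def R_def norm_divide)
  define C where "C = 2 * exp 2 * \<Lambda>"
  have C: "C > 0" using \<open>\<Lambda> > 0\<close> by (simp add: C_def)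
  define F where "F z = \<i> * z * deriv G z" for z
  have holF: "F holomorphic_on ball 0 1"
    unfolding F_def using hol by (intro holomorphic_intros) auto
  have F: "cmod (F (of_real b * u)) \<le> 2 * C / sqrt (1 - b) - 2 * C" if b: "0 \<le> b" "b < 1" for b
  proof -
    have "cmod (F (of_real b * u) - F (of_real 0 * u)) \<le> 2 * C / sqrt (1 - b) - 2 * C / sqrt (1 - 0)"
    proof (rule norm_diff_le_primitive[where \<phi> = "\<lambda>r. 2 * C / sqrt (1 - r)"
          and \<phi>' = "\<lambda>r. C / ((1 - r) * sqrt (1 - r))" and g' = "\<lambda>r. u * deriv F (of_real r * u)"])
      show "continuous_on {0..b} (\<lambda>r. F (of_real r * u))"
        by (rule continuous_on_compose2[OF holomorphic_on_imp_continuous_on[OF holF]]) (use b u in \<open>auto intro!: continuous_intros simp: norm_mult\<close>)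
      show "continuous_on {0..b} (\<lambda>r. 2 * C / sqrt (1 - r))"
        using b by (intro continuous_intros) auto
      fix x assume x: "0 < x" "x < b"
      then show "((\<lambda>r. F (of_real r * u)) has_vector_derivative u * deriv F (of_real x * u)) (at x)"
        using b u by (intro radial_vector_derivative[OF holF]) auto
      have "((\<lambda>r. 2 * C / sqrt (1 - r)) has_real_derivative C / ((1 - x) * sqrt (1 - x))) (at x)"
        using x b by (auto intro!: derivative_eq_intros simp: field_simps)
      then show "((\<lambda>r. 2 * C / sqrt (1 - r)) has_vector_derivative C / ((1 - x) * sqrt (1 - x))) (at x)"
        by (simp add: has_real_derivative_iff_has_vector_derivative)
      have "cmod (u * deriv F (of_real x * u)) \<le> C / (1 - x)"
        using norm_deriv_le_if_Re_bounded[OF holF \<open>\<Lambda> > 0\<close>, of "of_real x * u"] re x b u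
        by (simp add: F_def C_def norm_mult)
      \<comment> \<open>The weaker power -3/2 keeps logarithms out: its primitive is the power -1/2,
        which can be integrated once more up to the circle.\<close>
      also have "\<dots> \<le> C / ((1 - x) * sqrt (1 - x))"
        using x b C by (intro divide_left_mono) (auto simp: mult_le_cancel_left1)
      finally show "cmod (u * deriv F (of_real x * u)) \<le> C / ((1 - x) * sqrt (1 - x))" .
    qed (use b in auto)
    then show ?thesis by (simp add: F_def)
  qed
  have G': "cmod (deriv G (of_real x * u)) \<le> 2 * C / sqrt (1 - x)" if x: "0 < x" "x < 1" for x
  proof -
    \<comment> \<open>\<open>F\<close> vanishes at 0, and so does its bound because the constant
      \<open>- 2 * C\<close> was kept. Enlarging \<open>1 - q\<close> to
      \<open>1 - q\<^sup>2 = x\<close> produces the factor \<open>x\<close> that cancels the one in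
      \<open>F\<close>, so the bound on \<open>deriv G\<close> survives near the centre.\<close>
    define q where "q = sqrt (1 - x)"
    have q: "0 < q" "q < 1" "x = 1 - q\<^sup>2" using x by (auto simp: q_def real_sqrt_lt_1_iff)
    have "x * cmod (deriv G (of_real x * u)) = cmod (F (of_real x * u))"
      using x u by (simp add: F_def norm_mult)
    also have "\<dots> \<le> 2 * C / q - 2 * C" using F[of x] x by (simp add: q_def)
    also have "\<dots> = 2 * C * (1 - q) / q" using q by (simp add: field_simps)
    also have "\<dots> \<le> 2 * C * (1 - q\<^sup>2) / q"
      using q C by (intro divide_right_mono mult_left_mono) (auto simp: power2_eq_square mult_le_cancel_right1)
    finally have "x * cmod (deriv G (of_real x * u)) \<le> x * (2 * C / q)"
      using q by (simp add: mult.commute)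
    then show ?thesis using x unfolding q_def by (simp only: mult_le_cancel_left_pos)
  qed
  have "cmod (G (of_real R * u) - G (of_real 0 * u)) \<le> - 4 * C * sqrt (1 - R) - (- 4 * C * sqrt (1 - 0))"
  proof (rule norm_diff_le_primitive[where \<phi> = "\<lambda>r. - 4 * C * sqrt (1 - r)"
        and \<phi>' = "\<lambda>r. 2 * C / sqrt (1 - r)" and g' = "\<lambda>r. u * deriv G (of_real r * u)"])
    show "continuous_on {0..R} (\<lambda>r. G (of_real r * u))"
      by (rule continuous_on_compose2[OF holomorphic_on_imp_continuous_on[OF hol]]) (use R u in \<open>auto intro!: continuous_intros simp: norm_mult\<close>)
    show "continuous_on {0..R} (\<lambda>r. - 4 * C * sqrt (1 - r))"
      by (intro continuous_intros)
    fix x assume x: "0 < x" "x < R"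
    then show "((\<lambda>r. G (of_real r * u)) has_vector_derivative u * deriv G (of_real x * u)) (at x)"
      using R u by (intro radial_vector_derivative[OF hol]) auto
    have "((\<lambda>r. - 4 * C * sqrt (1 - r)) has_real_derivative 2 * C / sqrt (1 - x)) (at x)"
      using x R by (auto intro!: derivative_eq_intros simp: field_simps)
    then show "((\<lambda>r. - 4 * C * sqrt (1 - r)) has_vector_derivative 2 * C / sqrt (1 - x)) (at x)"
      by (simp add: has_real_derivative_iff_has_vector_derivative)
    show "cmod (u * deriv G (of_real x * u)) \<le> 2 * C / sqrt (1 - x)"
      using G'[of x] x R u by (simp add: norm_mult)
  qed (use R in auto)
  also have "\<dots> \<le> 4 * C" using C R by simp
  finally show ?thesis by (simp add: u(2)[symmetric] C_def)
qed

text \<open>The scaling by \<open>\<Lambda>\<close> breaks down at \<Lambda> = 0, which is the case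
  of identical profiles; it is reached as a limit from \<open>\<Lambda> + d\<close>.\<close>

lemma norm_diff_le_if_angular_derivative_bounded_nonneg:
  assumes hol: "G holomorphic_on ball 0 1"
    and re: "\<And>z. z \<in> ball 0 1 \<Longrightarrow> \<bar>Re (\<i> * z * deriv G z)\<bar> \<le> \<Lambda>" and z: "z \<in> ball 0 1"
  shows "cmod (G z - G 0) \<le> 8 * exp 2 * \<Lambda>"
proof (rule field_le_epsilon)
  fix e :: real assume e: "e > 0"
  have \<Lambda>: "\<Lambda> \<ge> 0" using re[of 0] by simp
  define d where "d = e / (8 * exp 2)"
  have d: "d > 0" using e by (simp add: d_def)
  have "cmod (G z - G 0) \<le> 8 * exp 2 * (\<Lambda> + d)"
  proof (rule norm_diff_le_if_angular_derivative_bounded[OF hol _ _ z])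
    show "\<bar>Re (\<i> * w * deriv G w)\<bar> \<le> \<Lambda> + d" if "w \<in> ball 0 1" for w using re[OF that] d by linarith
  qed (use \<Lambda> d in linarith)
  then show "cmod (G z - G 0) \<le> 8 * exp 2 * \<Lambda> + e" by (simp add: d_def distrib_left)
qed

text \<open>The boundary data pass to the interior through the maximum principle for zero-free
  holomorphic functions. The Lipschitz condition is transported as a bound on the finite quotients
  \<open>Q (z * cis h) / Q z\<close>, so that no derivative of the boundary values is taken; the
  angular derivative of the logarithm appears only inside, as \<open>h\<close> tends to 0.\<close>

lemma norm_minus_one_le_if_angular_log_lipschitz:
  fixes Q :: "complex \<Rightarrow> complex"
  assumes hol: "Q holomorphic_on ball 0 1" and cont: "continuous_on (cball 0 1) Q"
    and nz: "\<And>z. z \<in> cball 0 1 \<Longrightarrow> Q z \<noteq> 0"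
    and B: "\<And>z. cmod z = 1 \<Longrightarrow> \<bar>ln (cmod (Q z))\<bar> \<le> B"
    and lip: "\<And>z h. cmod z = 1 \<Longrightarrow> 0 < h \<Longrightarrow> h < 1 \<Longrightarrow>
                \<bar>ln (cmod (Q (z * cis h))) - ln (cmod (Q z))\<bar> \<le> \<Lambda> * h"
    and Q0: "Q 0 \<in> \<real>" "Re (Q 0) > 0" and z: "z \<in> cball 0 1"
  shows "cmod (Q z - 1) \<le> (B + 8 * exp 2 * \<Lambda>) * exp (B + 8 * exp 2 * \<Lambda>)"
proof -
  have norm_bound: "cmod (q z) \<le> b" if "q holomorphic_on ball 0 1" "continuous_on (cball 0 1) q"
    "\<And>z. cmod z = 1 \<Longrightarrow> cmod (q z) \<le> b" "z \<in> ball 0 1" for q :: "complex \<Rightarrow> complex" and b z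
    by (rule maximum_modulus_frontier[of q "ball 0 1" b]) (use that in auto)
  obtain G0 where G0: "G0 holomorphic_on ball 0 1" "\<And>z. z \<in> ball 0 1 \<Longrightarrow> exp (G0 z) = Q z"
  proof (rule holomorphic_logarithm_exists[OF convex_ball open_ball hol])
    show "Q z \<noteq> 0" if "z \<in> ball 0 1" for z using nz that by auto
    show "(0::complex) \<in> ball 0 1" by simp
  qed (use that in blast)
  \<comment> \<open>Among all logarithms of \<open>Q\<close> this one is real at 0. Then
    \<open>cmod (G 0)\<close> is the absolute value of \<open>ln (Re (Q 0))\<close> and involves no
    argument.\<close>
  define G where "G z = G0 z + (of_real (ln (Re (Q 0))) - G0 0)" for z
  have holG: "G holomorphic_on ball 0 1" unfolding G_def using G0 by (intro holomorphic_intros)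
  have "of_real (Re (Q 0)) = Q 0" using Q0 by simp
  then have expG: "exp (G z) = Q z" if "z \<in> ball 0 1" for z
    using that G0(2)[of z] G0(2)[of 0] Q0 nz[of 0]
    by (simp add: G_def exp_add exp_diff exp_of_real)
  have ReG: "Re (G z) = ln (cmod (Q z))" if "z \<in> ball 0 1" for z
    using expG[OF that, symmetric] by simp
  \<comment> \<open>The maximum principle for \<open>Q\<close> bounds its real logarithm at 0 from
    above, and for \<open>1 / Q\<close> from below.\<close>
  have "cmod (Q 0) \<le> exp B"
  proof (rule norm_bound[OF hol cont])
    show "cmod (Q z) \<le> exp B" if "cmod z = 1" for z
      using B[OF that] nz[of z] that by (metis abs_le_D1 dual_order.refl exp_le_cancel_iff exp_ln mem_cball_0 zero_less_norm_iff)
  qed auto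
  moreover have "cmod (inverse (Q 0)) \<le> exp B"
  proof (rule norm_bound[where q = "\<lambda>z. inverse (Q z)"])
    show "(\<lambda>z. inverse (Q z)) holomorphic_on ball 0 1" using hol nz by (intro holomorphic_intros) auto
    show "continuous_on (cball 0 1) (\<lambda>z. inverse (Q z))" using cont nz by (intro continuous_intros) auto
    show "cmod (inverse (Q z)) \<le> exp B" if "cmod z = 1" for z
    proof -
      have "exp (- ln (cmod (Q z))) \<le> exp B" using B[OF that] by auto
      then show ?thesis using nz[of z] that by (simp add: exp_minus norm_inverse)
    qed
  qed auto
  moreover have "cmod (Q 0) = Re (Q 0)"
    using \<open>of_real (Re (Q 0)) = Q 0\<close> Q0(2) by (metis abs_of_pos norm_of_real)
  ultimately have "exp (ln (Re (Q 0))) \<le> exp B" "exp (- ln (Re (Q 0))) \<le> exp B"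
    using Q0(2) by (simp_all add: exp_minus norm_inverse)
  then have "\<bar>ln (Re (Q 0))\<bar> \<le> B" unfolding exp_le_cancel_iff by linarith
  then have G_0: "cmod (G 0) \<le> B" by (simp add: G_def)
  \<comment> \<open>On the circle both \<open>Q (z * cis h) / Q z\<close> and its inverse have
    modulus at most \<open>exp (\<Lambda> * h)\<close>, hence also inside.\<close>
  have upper: "Re (G (z * cis h)) - Re (G z) \<le> \<Lambda> * h" "Re (G z) - Re (G (z * cis h)) \<le> \<Lambda> * h"
    if h: "0 < h" "h < 1" and z: "z \<in> ball 0 1" for z h
  proof -
    have rot: "w * cis h \<in> S" if "w \<in> S" "S = ball 0 1 \<or> S = cball 0 1" for w S
      using that by (auto simp: norm_mult)
    have [holomorphic_intros]: "(\<lambda>z. Q (z * cis h)) holomorphic_on ball 0 1"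
    proof -
      have "Q \<circ> (\<lambda>z. z * cis h) holomorphic_on ball 0 1"
        by (rule holomorphic_on_compose_gen[OF _ hol]) (auto intro!: holomorphic_intros simp: norm_mult)
      then show ?thesis by (simp add: o_def)
    qed
    have [continuous_intros]: "continuous_on (cball 0 1) (\<lambda>z. Q (z * cis h))"
      by (rule continuous_on_compose2[OF cont]) (use rot in \<open>auto intro!: continuous_intros simp: norm_mult\<close>)
    have ratio: "cmod (Q w / Q v) \<le> exp (\<Lambda> * h)" if "ln (cmod (Q w)) - ln (cmod (Q v)) \<le> \<Lambda> * h" "w \<in> cball 0 1" "v \<in> cball 0 1" for w v
    proof -
      have "exp (ln (cmod (Q w)) - ln (cmod (Q v))) \<le> exp (\<Lambda> * h)" using that by simp
      then show ?thesis using nz[of w] nz[of v] that by (simp add: exp_diff norm_divide)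
    qed
    have "cmod (Q (z * cis h) / Q z) \<le> exp (\<Lambda> * h)"
      by (rule norm_bound[of "\<lambda>z. Q (z * cis h) / Q z"]; (intro holomorphic_intros continuous_intros ratio)?)
         (use hol cont nz rot lip h z in \<open>auto simp: norm_mult abs_le_iff\<close>)
    then have "exp (Re (G (z * cis h) - G z)) \<le> exp (\<Lambda> * h)"
      using expG[of z] expG[of "z * cis h"] rot[of z] z by (metis exp_diff norm_exp_eq_Re)
    then show "Re (G (z * cis h)) - Re (G z) \<le> \<Lambda> * h" by simp
    have "cmod (Q z / Q (z * cis h)) \<le> exp (\<Lambda> * h)"
      by (rule norm_bound[of "\<lambda>z. Q z / Q (z * cis h)"]; (intro holomorphic_intros continuous_intros ratio)?)
         (use hol cont nz rot lip h z in \<open>auto simp: norm_mult abs_le_iff\<close>)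
    then have "exp (Re (G z - G (z * cis h))) \<le> exp (\<Lambda> * h)"
      using expG[of z] expG[of "z * cis h"] rot[of z] z by (metis exp_diff norm_exp_eq_Re)
    then show "Re (G z) - Re (G (z * cis h)) \<le> \<Lambda> * h" by simp
  qed
  have re: "\<bar>Re (\<i> * z * deriv G z)\<bar> \<le> \<Lambda>" if z: "z \<in> ball 0 1" for z
  proof -
    have a: "(G has_field_derivative deriv G z) (at (z * cis 0))"
      using holG z holomorphic_derivI open_ball by fastforce
    have b: "((\<lambda>h. z * cis h) has_vector_derivative z * (\<i> * cis 0)) (at 0)"
      unfolding has_vector_derivative_def by (auto intro!: derivative_eq_intros simp: scaleR_conv_of_real)
    have "((\<lambda>h. G (z * cis h)) has_vector_derivative (\<i> * z * deriv G z)) (at 0)"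
      using field_vector_diff_chain_at[OF b a] by (simp add: o_def mult_ac)
    then have "((\<lambda>h. Re (G (z * cis h))) has_vector_derivative Re (\<i> * z * deriv G z)) (at 0)"
      using bounded_linear.has_vector_derivative[OF bounded_linear_Re] by blast
    then have "((\<lambda>h. Re (G (z * cis h))) has_real_derivative Re (\<i> * z * deriv G z)) (at 0)"
      by (simp add: has_real_derivative_iff_has_vector_derivative)
    then have "((\<lambda>h. (Re (G (z * cis h)) - Re (G z)) / h) \<longlongrightarrow> Re (\<i> * z * deriv G z)) (at 0)"
      by (simp add: DERIV_def)
    \<comment> \<open>The difference quotients are controlled for positive \<open>h\<close>, and the
      one-sided limit already identifies the derivative.\<close>
    then have "((\<lambda>h. \<bar>(Re (G (z * cis h)) - Re (G z)) / h\<bar>) \<longlongrightarrow> \<bar>Re (\<i> * z * deriv G z)\<bar>) (at_right 0)"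
      by (intro tendsto_rabs) (simp add: filterlim_at_split)
    moreover have "\<forall>\<^sub>F h in at_right 0. \<bar>(Re (G (z * cis h)) - Re (G z)) / h\<bar> \<le> \<Lambda>"
      by (rule eventually_at_rightI[of 0 1]) (use upper z in \<open>auto simp: abs_le_iff field_simps\<close>)
    ultimately show ?thesis by (intro tendsto_upperbound) auto
  qed
  have bd: "cmod (Q z - 1) \<le> (B + 8 * exp 2 * \<Lambda>) * exp (B + 8 * exp 2 * \<Lambda>)" if z: "z \<in> ball 0 1" for z
  proof -
    have "cmod (G z) \<le> B + 8 * exp 2 * \<Lambda>"
      using norm_diff_le_if_angular_derivative_bounded_nonneg[OF holG re z] G_0
        norm_triangle_sub[of "G z" "G 0"] by linarith
    then have "cmod (G z) * exp (cmod (G z)) \<le> (B + 8 * exp 2 * \<Lambda>) * exp (B + 8 * exp 2 * \<Lambda>)"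
      by (intro mult_mono) (auto intro: order_trans[OF norm_ge_zero])
    then show ?thesis
      using norm_exp_minus_one_le[of "G z"] expG[OF z] by simp
  qed
  show ?thesis
  proof (rule continuous_on_closure_norm_le[of "ball 0 1" "\<lambda>z. Q z - 1"])
    show "continuous_on (closure (ball 0 1)) (\<lambda>z. Q z - 1)" using cont by (auto intro!: continuous_intros)
    show "\<forall>z\<in>ball 0 1. cmod (Q z - 1) \<le> (B + 8 * exp 2 * \<Lambda>) * exp (B + 8 * exp 2 * \<Lambda>)" using bd by blast
    show "z \<in> closure (ball 0 1)" using z by simp
  qed
qed

section \<open>The Green function of a conformal image of the disc\<close>

lemma second_derivative_nonpos_at_local_max:
  fixes k k' :: "real \<Rightarrow> real"
  assumes "d > 0" and k: "\<And>t. \<bar>t\<bar> < d \<Longrightarrow> (k has_real_derivative k' t) (at t)"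
    and k': "(k' has_real_derivative D) (at 0)" and max: "\<And>t. \<bar>t\<bar> < d \<Longrightarrow> k t \<le> k 0"
  shows "D \<le> 0"
proof (rule ccontr)
  assume "\<not> D \<le> 0"
  moreover have "k' 0 = 0"
    using k[of 0] \<open>d > 0\<close> max by (intro DERIV_local_max[of k "k' 0" 0 d]) auto
  ultimately obtain e where e: "e > 0" "\<And>h. 0 < h \<Longrightarrow> h < e \<Longrightarrow> k' h > 0"
    using DERIV_pos_inc_right[OF k'] by auto
  define t where "t = min d e / 2"
  have t: "0 < t" "t < d" "t < e" using e \<open>d > 0\<close> by (auto simp: t_def)
  have "k 0 < k t"
  proof (rule DERIV_pos_imp_increasing_open[where f = k and a = 0 and b = t])
    show "\<exists>y. DERIV k x :> y \<and> y > 0" if "0 < x" "x < t" for x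
      using k[of x] e(2)[of x] that t by auto
    show "continuous_on {0..t} k"
      using k t by (intro continuous_at_imp_continuous_on ballI DERIV_isCont[OF k]) auto
  qed (use t in auto)
  then show False using max[of t] t by simp
qed

lemma harmonic_onE:
  assumes "harmonic_on h S"
  obtains hx hy hxx hxy hyx hyy where
    "\<And>z. z \<in> S \<Longrightarrow> (h has_derivative (\<lambda>w. hx z * Re w + hy z * Im w)) (at z)"
    "\<And>z. z \<in> S \<Longrightarrow> (hx has_derivative (\<lambda>w. hxx z * Re w + hxy z * Im w)) (at z)"
    "\<And>z. z \<in> S \<Longrightarrow> (hy has_derivative (\<lambda>w. hyx z * Re w + hyy z * Im w)) (at z)"
    "\<And>z. z \<in> S \<Longrightarrow> hxx z + hyy z = 0"
    "continuous_on S hxx" "continuous_on S hxy" "continuous_on S hyx" "continuous_on S hyy"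
proof -
  obtain hx hy hxx hxy hyx hyy where
    "\<forall>z\<in>S. (h has_derivative (\<lambda>w. hx z * Re w + hy z * Im w)) (at z) \<and>
          (hx has_derivative (\<lambda>w. hxx z * Re w + hxy z * Im w)) (at z) \<and>
          (hy has_derivative (\<lambda>w. hyx z * Re w + hyy z * Im w)) (at z) \<and> hxx z + hyy z = 0"
    "continuous_on S hxx" "continuous_on S hxy" "continuous_on S hyx" "continuous_on S hyy"
    using assms unfolding harmonic_on_def by (elim exE conjE) (rule that)
  then show ?thesis by (intro that[of hx hy hxx hxy hyx hyy]) simp_all
qed

text \<open>A harmonic function may have a degenerate maximum. Adding
  \<open>\<epsilon> * (cmod z)\<^sup>2\<close> makes the Laplacian strictly positive, which rules
  out an interior maximum by the second derivative test. The function \<open>w\<close> carries the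
  boundary values, as \<open>h\<close> is harmonic on the open set only.\<close>

lemma harmonic_on_nonpos:
  assumes "open S" "bounded S" and harm: "harmonic_on h S" and cont: "continuous_on (closure S) w"
    and eq: "\<And>z. z \<in> S \<Longrightarrow> w z = h z" and bd: "\<And>z. z \<in> frontier S \<Longrightarrow> w z \<le> 0" and z0: "z0 \<in> S"
  shows "h z0 \<le> 0"
proof (rule ccontr)
  assume "\<not> h z0 \<le> 0"
  then have pos: "h z0 > 0" by simp
  obtain R where R: "R > 0" "\<And>z. z \<in> closure S \<Longrightarrow> cmod z \<le> R"
    using bounded_closure[OF \<open>bounded S\<close>] bounded_pos by metis
  \<comment> \<open>On the closure the perturbation is at most half of \<open>h z0\<close>, so it
    cannot lift a boundary value to the height of \<open>g z0\<close>.\<close>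
  define \<epsilon> where "\<epsilon> = h z0 / (2 * R\<^sup>2)"
  have \<epsilon>: "\<epsilon> > 0" "\<epsilon> * R\<^sup>2 < h z0" using pos R by (auto simp: \<epsilon>_def field_simps)
  define g where "g z = w z + \<epsilon> * (cmod z)\<^sup>2" for z
  have "continuous_on (closure S) g" unfolding g_def by (intro continuous_intros cont)
  moreover have "compact (closure S)" using \<open>bounded S\<close> by simp
  moreover have "closure S \<noteq> {}" using z0 by auto
  ultimately obtain z1 where z1: "z1 \<in> closure S" "\<And>z. z \<in> closure S \<Longrightarrow> g z \<le> g z1"
    using continuous_attains_sup[of "closure S" g] by auto
  have "z1 \<in> S"
  proof (rule ccontr)
    assume "z1 \<notin> S"
    then have "w z1 \<le> 0" using bd z1(1) interior_subset by (auto simp: frontier_def)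
    moreover have "\<epsilon> * (cmod z1)\<^sup>2 \<le> \<epsilon> * R\<^sup>2"
      using R(2)[OF z1(1)] \<epsilon> by (intro mult_left_mono power_mono) auto
    moreover have "h z0 \<le> g z0" using eq[OF z0] \<epsilon> by (simp add: g_def)
    moreover have "g z0 \<le> g z1" using z1(2) z0 closure_subset by blast
    ultimately show False using \<epsilon> unfolding g_def by linarith
  qed
  then obtain d where d: "d > 0" "ball z1 d \<subseteq> S" using \<open>open S\<close> openE by blast
  obtain hx hy hxx hxy hyx hyy where H:
    "\<And>z. z \<in> S \<Longrightarrow> (h has_derivative (\<lambda>w. hx z * Re w + hy z * Im w)) (at z)"
    "\<And>z. z \<in> S \<Longrightarrow> (hx has_derivative (\<lambda>w. hxx z * Re w + hxy z * Im w)) (at z)"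
    "\<And>z. z \<in> S \<Longrightarrow> (hy has_derivative (\<lambda>w. hyx z * Re w + hyy z * Im w)) (at z)"
    "\<And>z. z \<in> S \<Longrightarrow> hxx z + hyy z = 0"
    "continuous_on S hxx" "continuous_on S hxy" "continuous_on S hyx" "continuous_on S hyy"
    using harm by (rule harmonic_onE) (rule that)
  have inS: "z1 + of_real t * v \<in> S" if "\<bar>t\<bar> < d" "cmod v = 1" for t v
    using d that by (auto simp: subset_iff dist_norm norm_mult)
  have line: "((\<lambda>t. F (z1 + of_real t * v)) has_real_derivative a * Re v + b * Im v) (at t)"
    if "(F has_derivative (\<lambda>w. a * Re w + b * Im w)) (at (z1 + of_real t * v))" for F :: "complex \<Rightarrow> real" and a b t v
  proof -
    have "((\<lambda>t. z1 + of_real t * v) has_derivative (\<lambda>s. of_real s * v)) (at t)"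
      by (auto intro!: derivative_eq_intros)
    from has_derivative_compose[OF this that]
    show ?thesis unfolding has_field_derivative_def
      by (rule has_derivative_eq_rhs) (simp add: fun_eq_iff algebra_simps)
  qed
  have sq: "(cmod (z1 + of_real t * v))\<^sup>2 = (cmod z1)\<^sup>2 + 2 * t * (Re z1 * Re v + Im z1 * Im v) + t\<^sup>2"
    if "cmod v = 1" for t v
  proof -
    have "(Re v)\<^sup>2 + (Im v)\<^sup>2 = 1" using that by (simp add: cmod_def)
    then have "t\<^sup>2 * ((Re v)\<^sup>2 + (Im v)\<^sup>2) = t\<^sup>2" by simp
    then show ?thesis unfolding cmod_power2 by (simp add: power2_eq_square algebra_simps)
  qed
  have test: "(hxx z1 * Re v + hxy z1 * Im v) * Re v + (hyx z1 * Re v + hyy z1 * Im v) * Im v + 2 * \<epsilon> \<le> 0"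
    if v: "cmod v = 1" for v
  proof (rule second_derivative_nonpos_at_local_max)
    define P where "P t = z1 + of_real t * v" for t :: real
    define k where "k t = h (P t) + \<epsilon> * ((cmod z1)\<^sup>2 + 2 * t * (Re z1 * Re v + Im z1 * Im v) + t\<^sup>2)" for t
    define k' where "k' t = hx (P t) * Re v + hy (P t) * Im v + \<epsilon> * (2 * (Re z1 * Re v + Im z1 * Im v) + 2 * t)" for t
    have kg: "k t = g (P t)" if "\<bar>t\<bar> < d" for t
      using inS[OF that v] eq sq[OF v] by (simp add: k_def g_def P_def)
    show "(k has_real_derivative k' t) (at t)" if "\<bar>t\<bar> < d" for t
      unfolding k_def k'_def P_def
      using line[OF H(1)[OF inS[OF that v]]] by (auto intro!: derivative_eq_intros)
    have 0: "z1 + of_real 0 * v \<in> S" using \<open>z1 \<in> S\<close> by simp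
    show "(k' has_real_derivative (hxx z1 * Re v + hxy z1 * Im v) * Re v
        + (hyx z1 * Re v + hyy z1 * Im v) * Im v + 2 * \<epsilon>) (at 0)"
      unfolding k'_def P_def
      using line[OF H(2)[OF 0]] line[OF H(3)[OF 0]] by (auto intro!: derivative_eq_intros)
    show "k t \<le> k 0" if "\<bar>t\<bar> < d" for t
      using kg[OF that] kg[of 0] d(1) z1(2)[of "P t"] inS[OF that v] closure_subset[of S]
      by (auto simp: P_def)
  qed fact
  \<comment> \<open>The two coordinate directions add up to the Laplacian plus
    \<open>4 * \<epsilon>\<close>, which would have to be nonpositive.\<close>
  show False using test[of 1] test[of \<i>] H(4)[OF \<open>z1 \<in> S\<close>] \<epsilon> by simp
qed

lemma harmonic_on_diff:
  assumes "harmonic_on h S" "harmonic_on k S"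
  shows "harmonic_on (\<lambda>z. h z - k z) S"
proof -
  obtain hx hy hxx hxy hyx hyy where H:
    "\<And>z. z \<in> S \<Longrightarrow> (h has_derivative (\<lambda>w. hx z * Re w + hy z * Im w)) (at z)"
    "\<And>z. z \<in> S \<Longrightarrow> (hx has_derivative (\<lambda>w. hxx z * Re w + hxy z * Im w)) (at z)"
    "\<And>z. z \<in> S \<Longrightarrow> (hy has_derivative (\<lambda>w. hyx z * Re w + hyy z * Im w)) (at z)"
    "\<And>z. z \<in> S \<Longrightarrow> hxx z + hyy z = 0"
    "continuous_on S hxx" "continuous_on S hxy" "continuous_on S hyx" "continuous_on S hyy"
    using assms(1) by (rule harmonic_onE) (rule that)
  obtain kx ky kxx kxy kyx kyy where K:
    "\<And>z. z \<in> S \<Longrightarrow> (k has_derivative (\<lambda>w. kx z * Re w + ky z * Im w)) (at z)"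
    "\<And>z. z \<in> S \<Longrightarrow> (kx has_derivative (\<lambda>w. kxx z * Re w + kxy z * Im w)) (at z)"
    "\<And>z. z \<in> S \<Longrightarrow> (ky has_derivative (\<lambda>w. kyx z * Re w + kyy z * Im w)) (at z)"
    "\<And>z. z \<in> S \<Longrightarrow> kxx z + kyy z = 0"
    "continuous_on S kxx" "continuous_on S kxy" "continuous_on S kyx" "continuous_on S kyy"
    using assms(2) by (rule harmonic_onE) (rule that)
  have diff: "((\<lambda>z. F z - G z) has_derivative (\<lambda>w. (a - c) * Re w + (b - e) * Im w)) (at z)"
    if "(F has_derivative (\<lambda>w. a * Re w + b * Im w)) (at z)"
      "(G has_derivative (\<lambda>w. c * Re w + e * Im w)) (at z)" for F G :: "complex \<Rightarrow> real" and a b c e z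
    using has_derivative_diff[OF that] by (simp add: algebra_simps)
  have lap: "hxx z - kxx z + (hyy z - kyy z) = 0" if "z \<in> S" for z
    using H(4)[OF that] K(4)[OF that] by linarith
  show ?thesis
    unfolding harmonic_on_def
    by (rule exI[of _ "\<lambda>z. hx z - kx z"], rule exI[of _ "\<lambda>z. hy z - ky z"],
        rule exI[of _ "\<lambda>z. hxx z - kxx z"], rule exI[of _ "\<lambda>z. hxy z - kxy z"],
        rule exI[of _ "\<lambda>z. hyx z - kyx z"], rule exI[of _ "\<lambda>z. hyy z - kyy z"])
       (intro conjI ballI diff[OF H(1) K(1)] diff[OF H(2) K(2)] diff[OF H(3) K(3)]
          continuous_on_diff[OF H(5) K(5)] continuous_on_diff[OF H(6) K(6)]
          continuous_on_diff[OF H(7) K(7)] continuous_on_diff[OF H(8) K(8)] lap)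
qed

lemma harmonic_on_Re_holomorphic:
  assumes "open S" and hol: "F holomorphic_on S"
  shows "harmonic_on (\<lambda>z. Re (F z)) S"
proof -
  have der: "(\<phi> has_field_derivative deriv \<phi> z) (at z)" if "\<phi> holomorphic_on S" "z \<in> S" for \<phi> z
    using that \<open>open S\<close> holomorphic_derivI by blast
  have Re: "((\<lambda>z. Re (\<phi> z)) has_derivative (\<lambda>w. Re (deriv \<phi> z) * Re w + (- Im (deriv \<phi> z)) * Im w)) (at z)"
    and Im: "((\<lambda>z. - Im (\<phi> z)) has_derivative (\<lambda>w. (- Im (deriv \<phi> z)) * Re w + (- Re (deriv \<phi> z)) * Im w)) (at z)"
    if "\<phi> holomorphic_on S" "z \<in> S" for \<phi> z
    using has_derivative_Re[OF der[OF that, unfolded has_field_derivative_def]]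
      has_derivative_minus[OF has_derivative_Im[OF der[OF that, unfolded has_field_derivative_def]]]
    by (simp_all add: algebra_simps)
  have hol': "deriv F holomorphic_on S" "deriv (deriv F) holomorphic_on S"
    using hol \<open>open S\<close> by (auto intro: holomorphic_deriv)
  have cont: "continuous_on S (deriv (deriv F))" using hol'(2) by (rule holomorphic_on_imp_continuous_on)
  show ?thesis
    unfolding harmonic_on_def
    by (rule exI[of _ "\<lambda>z. Re (deriv F z)"], rule exI[of _ "\<lambda>z. - Im (deriv F z)"],
        rule exI[of _ "\<lambda>z. Re (deriv (deriv F) z)"], rule exI[of _ "\<lambda>z. - Im (deriv (deriv F) z)"],
        rule exI[of _ "\<lambda>z. - Im (deriv (deriv F) z)"], rule exI[of _ "\<lambda>z. - Re (deriv (deriv F) z)"])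
       (use Re[OF hol] Re[OF hol'(1)] Im[OF hol'(1)] cont in \<open>auto intro!: continuous_intros\<close>)
qed

text \<open>The logarithmic singularities cancel, so \<open>u - v\<close> continues across
  \<open>\<zeta>\<close> as the harmonic function \<open>h - k\<close>, to which the maximum
  principle applies. Exchanging \<open>u\<close> and \<open>v\<close> gives uniqueness.\<close>

lemma point_source_le:
  assumes "open \<Omega>" "bounded \<Omega>" "\<zeta> \<in> \<Omega>"
    and u: "dirichlet_point_source \<Omega> \<zeta> u" and v: "dirichlet_point_source \<Omega> \<zeta> v"
    and z: "z \<in> closure \<Omega> - {\<zeta>}"
  shows "u z \<le> v z"
proof -
  obtain h where h: "harmonic_on h \<Omega>" "\<And>z. z \<in> \<Omega> - {\<zeta>} \<Longrightarrow> u z = - ln (cmod (z - \<zeta>)) / (2 * pi) + h z"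
    using u unfolding dirichlet_point_source_def by blast
  obtain k where k: "harmonic_on k \<Omega>" "\<And>z. z \<in> \<Omega> - {\<zeta>} \<Longrightarrow> v z = - ln (cmod (z - \<zeta>)) / (2 * pi) + k z"
    using v unfolding dirichlet_point_source_def by blast
  have cont: "continuous_on (closure \<Omega> - {\<zeta>}) u" "continuous_on (closure \<Omega> - {\<zeta>}) v"
    and bd: "\<And>z. z \<in> frontier \<Omega> \<Longrightarrow> u z = 0" "\<And>z. z \<in> frontier \<Omega> \<Longrightarrow> v z = 0"
    using u v by (auto simp: dirichlet_point_source_def)
  have hk: "harmonic_on (\<lambda>z. h z - k z) \<Omega>" by (rule harmonic_on_diff[OF h(1) k(1)])
  \<comment> \<open>The values of \<open>u\<close> and \<open>v\<close> at the pole are arbitrary;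
    on \<Omega> the regular parts are used instead. Continuity is checked on two relatively open
    pieces on whose overlap both formulas agree.\<close>
  define w where "w z = (if z \<in> \<Omega> then h z - k z else u z - v z)" for z
  have w_eq: "w z = u z - v z" if "z \<noteq> \<zeta>" for z
    using h(2)[of z] k(2)[of z] that by (auto simp: w_def)
  have "continuous_on ((closure \<Omega> - {\<zeta>}) \<union> \<Omega>) w"
  proof (rule continuous_on_Un_local_open)
    have eq: "(closure \<Omega> - {\<zeta>}) \<union> \<Omega> = closure \<Omega>" using \<open>\<zeta> \<in> \<Omega>\<close> closure_subset by blast
    have "closure \<Omega> - {\<zeta>} = closure \<Omega> \<inter> - {\<zeta>}" by blast
    then show "openin (top_of_set ((closure \<Omega> - {\<zeta>}) \<union> \<Omega>)) (closure \<Omega> - {\<zeta>})"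
      unfolding eq by (metis openin_open_Int open_Compl closed_singleton)
    have "\<Omega> = closure \<Omega> \<inter> \<Omega>" using closure_subset by blast
    then show "openin (top_of_set ((closure \<Omega> - {\<zeta>}) \<union> \<Omega>)) \<Omega>"
      unfolding eq by (metis openin_open_Int \<open>open \<Omega>\<close>)
    have "continuous_on (closure \<Omega> - {\<zeta>}) (\<lambda>z. u z - v z)" using cont by (intro continuous_intros)
    then show "continuous_on (closure \<Omega> - {\<zeta>}) w" by (rule continuous_on_eq) (simp add: w_eq)
    have "continuous_on \<Omega> (\<lambda>z. h z - k z)"
      by (rule harmonic_onE[OF hk]) (metis continuous_at_imp_continuous_on has_derivative_continuous)
    then show "continuous_on \<Omega> w" by (rule continuous_on_eq) (simp add: w_def)
  qed
  moreover have "(closure \<Omega> - {\<zeta>}) \<union> \<Omega> = closure \<Omega>" using \<open>\<zeta> \<in> \<Omega>\<close> closure_subset by blast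
  ultimately have cont_w: "continuous_on (closure \<Omega>) w" by simp
  have fr: "w z = 0" if "z \<in> frontier \<Omega>" for z
    using that bd[OF that] frontier_disjoint_eq[of \<Omega>] \<open>open \<Omega>\<close> by (auto simp: w_def)
  show ?thesis
  proof (cases "z \<in> \<Omega>")
    case True
    have "h z - k z \<le> 0"
    proof (rule harmonic_on_nonpos[OF \<open>open \<Omega>\<close> \<open>bounded \<Omega>\<close> hk cont_w _ _ True])
      show "w z = h z - k z" if "z \<in> \<Omega>" for z using that by (simp add: w_def)
      show "w z \<le> 0" if "z \<in> frontier \<Omega>" for z using fr[OF that] by simp
    qed
    then show ?thesis using h(2)[of z] k(2)[of z] True z by simp
  next
    case False
    then have "z \<in> frontier \<Omega>" using z \<open>open \<Omega>\<close> by (simp add: frontier_def interior_open)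
    then show ?thesis using bd by simp
  qed
qed

lemma point_source_unique:
  assumes "open \<Omega>" "bounded \<Omega>" "\<zeta> \<in> \<Omega>"
    and "dirichlet_point_source \<Omega> \<zeta> u" "dirichlet_point_source \<Omega> \<zeta> v" "z \<in> closure \<Omega> - {\<zeta>}"
  shows "u z = v z"
  using point_source_le[OF assms(1-3)] assms(4-6) by (meson order_antisym)

section \<open>Conformal maps smooth up to the circle and their Green function\<close>

lemma holder_continuous_on_imp_continuous_on:
  assumes "0 < \<alpha>" "holder_continuous_on \<alpha> S g"
  shows "continuous_on S g"
proof -
  obtain C where C: "\<And>x y. x \<in> S \<Longrightarrow> y \<in> S \<Longrightarrow> dist (g x) (g y) \<le> C * dist x y powr \<alpha>"
    using assms(2) unfolding holder_continuous_on_def by blast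
  have "((\<lambda>y. dist (g y) (g x)) \<longlongrightarrow> 0) (at x within S)" if "x \<in> S" for x
  proof (rule tendsto_sandwich[of "\<lambda>_. 0" _ _ "\<lambda>y. C * dist y x powr \<alpha>"])
    show "\<forall>\<^sub>F y in at x within S. dist (g y) (g x) \<le> C * dist y x powr \<alpha>"
      using C that by (auto simp: eventually_at_filter)
    have "((\<lambda>y. dist y x) \<longlongrightarrow> 0) (at x within S)"
      using tendsto_dist[OF tendsto_ident_at[of x S] tendsto_const[of x]] by simp
    then have "((\<lambda>y. C * dist y x powr \<alpha>) \<longlongrightarrow> C * (0 powr \<alpha>)) (at x within S)"
      using assms(1) by (intro tendsto_mult tendsto_const tendsto_powr') auto
    then show "((\<lambda>y. C * dist y x powr \<alpha>) \<longlongrightarrow> 0) (at x within S)" by simp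
  qed auto
  then show ?thesis unfolding continuous_on by (subst tendsto_dist_iff) auto
qed

text \<open>Here \<open>f'\<close> is a derivative relative to the closed disc, and it may a priori
  vanish on the circle. The regularity of the image boundary serves to decide on which side of the
  curve the normal points.\<close>

locale disc_map =
  fixes \<alpha> :: real and f f' :: "complex \<Rightarrow> complex"
  assumes \<alpha>: "0 < \<alpha>" and hol: "f holomorphic_on ball 0 1"
    and der: "\<And>z. z \<in> cball 0 1 \<Longrightarrow> (f has_field_derivative f' z) (at z within cball 0 1)"
    and f'_holder: "holder_continuous_on \<alpha> (cball 0 1) f'"
    and inj: "inj_on f (cball 0 1)" and bdry: "C1_holder_boundary \<alpha> (f ` ball 0 1)"
begin

lemma cont: "continuous_on (cball 0 1) f"
  using der by (meson DERIV_continuous_on)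

lemma cont': "continuous_on (cball 0 1) f'"
  using holder_continuous_on_imp_continuous_on[OF \<alpha> f'_holder] .

lemma f'_eq: "z \<in> ball 0 1 \<Longrightarrow> f' z = deriv f z"
  using der[of z] at_within_interior[of z "cball 0 1"] by (simp add: DERIV_imp_deriv)

lemma f'_holomorphic: "f' holomorphic_on ball 0 1"
  using holomorphic_transform[OF holomorphic_deriv[OF hol open_ball]] f'_eq by metis

lemma f'_ball_nonzero: "z \<in> ball 0 1 \<Longrightarrow> f' z \<noteq> 0"
  using holomorphic_injective_imp_regular[OF hol open_ball inj_on_subset[OF inj ball_subset_cball]] f'_eq
  by auto

lemma open_image: "open (f ` ball 0 1)"
  using open_mapping_thm3[OF hol open_ball inj_on_subset[OF inj ball_subset_cball]] .

lemma compact_image: "compact (f ` cball 0 1)"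
  using compact_continuous_image[OF cont] by simp

lemma closure_image: "closure (f ` ball 0 1) = f ` cball 0 1"
proof
  show "closure (f ` ball 0 1) \<subseteq> f ` cball 0 1"
    using compact_image by (intro closure_minimal) (auto simp: compact_imp_closed)
  show "f ` cball 0 1 \<subseteq> closure (f ` ball 0 1)"
    using image_closure_subset[of "ball 0 1" f "closure (f ` ball 0 1)"] cont closure_subset[of "f ` ball 0 1"] by simp
qed

lemma bounded_image: "bounded (f ` ball 0 1)"
  using compact_image compact_imp_bounded bounded_subset[of "f ` cball 0 1" "f ` ball 0 1"] by (metis ball_subset_cball image_mono)

lemma frontier_image: "frontier (f ` ball 0 1) = f ` sphere 0 1"
proof -
  have "frontier (f ` ball 0 1) = f ` cball 0 1 - f ` ball 0 1"
    by (simp add: frontier_def closure_image interior_open[OF open_image])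
  also have "\<dots> = f ` (cball 0 1 - ball 0 1)"
    by (rule inj_on_image_set_diff[OF inj, symmetric]) auto
  finally show ?thesis by (simp add: cball_diff_eq_sphere)
qed

definition g where "g = the_inv_into (cball 0 1) f"

lemma g_f: "z \<in> cball 0 1 \<Longrightarrow> g (f z) = z"
  unfolding g_def by (rule the_inv_into_f_f[OF inj])

lemma cont_g: "continuous_on (f ` cball 0 1) g"
  using continuous_on_inv[OF cont] g_f by auto

lemma g_holomorphic: "g holomorphic_on f ` ball 0 1"
proof -
  obtain k where "k holomorphic_on f ` ball 0 1" "\<And>z. z \<in> ball 0 1 \<Longrightarrow> k (f z) = z"
    using holomorphic_has_inverse[OF hol open_ball inj_on_subset[OF inj ball_subset_cball]] by metis
  then show ?thesis using g_f by (subst holomorphic_cong[OF refl, of _ g k]) auto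
qed

text \<open>The Green function of the disc with pole 0, transplanted by the inverse map; Green
  functions are conformally invariant.\<close>

definition green where "green w = - ln (cmod (g w)) / (2 * pi)"

text \<open>The regular part is explicit. The quotient \<open>(f z - f 0) / z\<close>, completed at
  0 by the derivative, has no zeros since \<open>f\<close> is injective with nonzero derivative
  there. Its holomorphic logarithm, pulled back by \<open>g\<close> and divided by
  \<open>2 * pi\<close>, has as real part exactly the difference between \<open>green\<close> and
  the fundamental solution.\<close>

lemma green_solves: "dirichlet_point_source (f ` ball 0 1) (f 0) green"
proof -
  define k where "k z = (if z = 0 then deriv f 0 else (f z - f 0) / z)" for z
  have "k holomorphic_on ball 0 1"
  proof (rule pole_theorem_open_0[of "\<lambda>z. f z - f 0" _ 0])
    have "deriv (\<lambda>z. f z - f 0) 0 = deriv f 0"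
      using holomorphic_derivI[OF hol open_ball, of 0] by (auto intro!: DERIV_imp_deriv derivative_eq_intros)
    then show "k 0 = deriv (\<lambda>z. f z - f 0) 0" by (simp add: k_def)
  qed (auto simp: k_def intro!: holomorphic_intros hol)
  moreover have "k z \<noteq> 0" if "z \<in> ball 0 1" for z
    using that f'_ball_nonzero[of 0] f'_eq[of 0] inj_onD[OF inj, of z 0] by (auto simp: k_def)
  ultimately obtain F where F: "F holomorphic_on ball 0 1" "\<And>z. z \<in> ball 0 1 \<Longrightarrow> exp (F z) = k z"
    by (rule holomorphic_logarithm_exists[OF convex_ball open_ball _ _ centre_in_ball[THEN iffD2, OF zero_less_one]])
       (assumption, rule that)
  define H where "H w = F (g w) / (2 * pi)" for w
  have "F \<circ> g holomorphic_on f ` ball 0 1"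
    using g_f by (intro holomorphic_on_compose_gen[OF g_holomorphic F(1)]) auto
  then have "H holomorphic_on f ` ball 0 1"
    unfolding H_def o_def by (intro holomorphic_intros) auto
  then have "harmonic_on (\<lambda>w. Re (H w)) (f ` ball 0 1)"
    by (rule harmonic_on_Re_holomorphic[OF open_image])
  moreover have "green w = - ln (cmod (w - f 0)) / (2 * pi) + Re (H w)" if w: "w \<in> f ` ball 0 1 - {f 0}" for w
  proof -
    obtain z where z0: "z \<in> ball 0 1" "w = f z" using w by blast
    then have z: "z \<in> ball 0 1" "w = f z" "z \<noteq> 0" using w by auto
    then have nz: "f z - f 0 \<noteq> 0" using w by auto
    have "Re (F z) = ln (cmod (k z))" using F(2)[OF z(1), symmetric] by simp
    also have "\<dots> = ln (cmod (f z - f 0)) - ln (cmod z)"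
      using z nz by (simp add: k_def norm_divide ln_div)
    finally have ReF: "Re (F z) = ln (cmod (f z - f 0)) - ln (cmod z)" .
    have "g w = z" using z g_f[of z] by auto
    moreover have "Re (H w) = Re (F (g w)) / (2 * pi)" unfolding H_def by (rule Re_divide_of_real)
    ultimately show ?thesis unfolding green_def using ReF z(2) by (simp add: diff_divide_distrib)
  qed
  moreover have "continuous_on (f ` cball 0 1 - {f 0}) green"
    unfolding green_def
    by (intro continuous_intros continuous_on_subset[OF cont_g]) (use g_f in auto)
  moreover have "green w = 0" if "w \<in> f ` sphere 0 1" for w
    using that g_f by (auto simp: green_def)
  ultimately show ?thesis
    unfolding dirichlet_point_source_def closure_image frontier_image by blast
qed

lemma point_source_solution_eq:
  assumes "w \<in> f ` cball 0 1 - {f 0}"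
  shows "point_source_solution (f ` ball 0 1) (f 0) w = green w"
proof (rule point_source_unique[OF open_image bounded_image])
  show "dirichlet_point_source (f ` ball 0 1) (f 0) (point_source_solution (f ` ball 0 1) (f 0))"
    unfolding point_source_solution_def by (rule someI[where P = "dirichlet_point_source (f ` ball 0 1) (f 0)", OF green_solves])
qed (use green_solves assms closure_image in auto)

end

section \<open>The normal derivative on the boundary\<close>

context disc_map
begin

text \<open>The circle lies in the closed disc, so a derivative of \<open>f\<close> relative to the
  disc suffices for a two-sided derivative in the angle.\<close>

lemma curve_deriv:
  "(bdry_curve f has_vector_derivative \<i> * cis \<theta> * f' (cis \<theta>)) (at \<theta>)"
proof -
  have "((\<lambda>t. cis t) has_vector_derivative \<i> * cis \<theta>) (at \<theta>)"
    unfolding has_vector_derivative_def by (auto intro!: derivative_eq_intros simp: scaleR_conv_of_real)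
  moreover have "(f has_field_derivative f' (cis \<theta>)) (at (cis \<theta>) within range cis)"
    using der[of "cis \<theta>"] by (rule DERIV_subset) auto
  ultimately have "(f \<circ> cis has_vector_derivative \<i> * cis \<theta> * f' (cis \<theta>)) (at \<theta>)"
    by (rule field_vector_diff_chain_within)
  then show ?thesis by (simp add: o_def bdry_curve_def[abs_def])
qed

lemma radius_deriv:
  assumes "cmod z = 1"
  shows "((\<lambda>t. f (z * of_real (1 - t))) has_vector_derivative - z * f' z) (at_right 0)"
proof -
  define X where "X t = z * of_real (1 - t)" for t :: real
  have "(X has_vector_derivative - z) (at 0 within {0..1})"
    unfolding X_def has_vector_derivative_def
    by (auto intro!: derivative_eq_intros simp: scaleR_conv_of_real)
  moreover have "(f has_field_derivative f' z) (at (X 0) within X ` {0..1})"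
  proof (rule DERIV_subset)
    show "(f has_field_derivative f' z) (at (X 0) within cball 0 1)" using der[of z] assms by (simp add: X_def)
    show "X ` {0..1} \<subseteq> cball 0 1" using assms by (auto simp: X_def norm_mult simp del: of_real_diff)
  qed
  ultimately have "(f \<circ> X has_vector_derivative - z * f' z) (at 0 within {0..1})"
    by (rule field_vector_diff_chain_within)
  then show ?thesis by (simp add: o_def X_def at_within_Icc_at_right)
qed

text \<open>
  In the graph coordinates \<open>w = (z - \<zeta>) / \<tau>\<close> the defining function \<open>Im w - h (Re w)\<close> is nonpositive
  along the boundary curve and positive along the image of the radius. So its differential vanishes on
  the tangent and is positive on the normal.
\<close>
lemma interior_normal_points_inside:
  assumes z: "cmod z = 1" and nz: "f' z \<noteq> 0"
  shows "\<forall>\<^sub>F t in at_right 0. f z + of_real t * (- sgn (z * f' z)) \<in> f ` ball 0 1"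
proof -
  define \<Omega> where "\<Omega> = f ` ball 0 1"
  have fr: "f z \<in> frontier \<Omega>" unfolding \<Omega>_def frontier_image using z by auto
  have not_in: "f w \<notin> \<Omega>" if "cmod w = 1" for w
  proof
    assume "f w \<in> \<Omega>"
    then obtain v where "v \<in> ball 0 1" "f v = f w" unfolding \<Omega>_def by (auto simp del: mem_ball_0)
    then have "v = w" using that inj_onD[OF inj, of v w] by auto
    then show False using \<open>v \<in> ball 0 1\<close> that by simp
  qed
  obtain \<tau> r and h h' :: "real \<Rightarrow> real" where \<tau>: "cmod \<tau> = 1" and r: "r > 0"
    and h: "\<forall>x\<in>{-r..r}. (h has_real_derivative h' x) (at x)"
    and graph: "\<forall>w\<in>ball (f z) r. w \<in> \<Omega> \<longleftrightarrow> Im ((w - f z) / \<tau>) > h (Re ((w - f z) / \<tau>))"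
    using bspec[OF bdry[unfolded C1_holder_boundary_def] fr[unfolded \<Omega>_def], folded \<Omega>_def]
    by (elim exE conjE) (rule that)
  define k where "k w = Im ((w - f z) / \<tau>) - h (Re ((w - f z) / \<tau>))" for w
  \<comment> \<open>The differential at \<open>f z\<close> of the defining function
    \<open>k\<close>.\<close>
  define l where "l v = Im (v / \<tau>) - h' 0 * Re (v / \<tau>)" for v
  have h0: "(h has_real_derivative h' 0) (at 0)" using h r by simp
  have k_at: "w \<in> \<Omega> \<longleftrightarrow> k w > 0" if "w \<in> ball (f z) r" for w
    using bspec[OF graph that] by (simp add: k_def)
  have k_fz: "k (f z) = - h 0" by (simp add: k_def)
  have k_deriv: "((\<lambda>t. k (X t)) has_real_derivative l v) (at a within S)"
    if X: "(X has_vector_derivative v) (at a within S)" "X a = f z" for X :: "real \<Rightarrow> complex" and v a S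
  proof -
    have Y: "((\<lambda>t. (X t - f z) / \<tau>) has_vector_derivative v / \<tau>) (at a within S)"
      using has_vector_derivative_diff[OF X(1) has_vector_derivative_const[of "f z"]]
        bounded_linear.has_vector_derivative[OF bounded_linear_divide[of \<tau>]] by fastforce
    have Re: "((\<lambda>t. Re ((X t - f z) / \<tau>)) has_real_derivative Re (v / \<tau>)) (at a within S)"
      using bounded_linear.has_vector_derivative[OF bounded_linear_Re Y]
      by (simp add: has_real_derivative_iff_has_vector_derivative)
    have Im: "((\<lambda>t. Im ((X t - f z) / \<tau>)) has_real_derivative Im (v / \<tau>)) (at a within S)"
      using bounded_linear.has_vector_derivative[OF bounded_linear_Im Y]
      by (simp add: has_real_derivative_iff_has_vector_derivative)
    have "(h has_real_derivative h' 0) (at (Re ((X a - f z) / \<tau>)))"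
      using h0 X(2) by simp
    from DERIV_chain2[OF this Re] show ?thesis
      unfolding k_def l_def by (rule DERIV_diff[OF Im])
  qed
  have near: "\<forall>\<^sub>F t in at a within S. X t \<in> ball (f z) r"
    if "(X has_vector_derivative v) (at a within S)" "X a = f z" for X :: "real \<Rightarrow> complex" and v a S
  proof -
    have "(X \<longlongrightarrow> f z) (at a within S)"
      using has_vector_derivative_continuous[OF that(1)] that(2) by (simp add: continuous_within)
    then have "\<forall>\<^sub>F t in at a within S. X t \<in> ball (f z) r"
      by (rule topological_tendstoD) (use r in auto)
    then show ?thesis .
  qed
  define n where "n = - (z * f' z)"
  define X where "X t = f (z * of_real (1 - t))" for t :: real
  have X: "(X has_vector_derivative n) (at_right 0)" "X 0 = f z"
    using radius_deriv[OF z] by (simp_all add: X_def[abs_def] n_def)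
  have "\<forall>\<^sub>F t in at_right (0::real). t < 1"
    by (rule eventually_at_rightI[of 0 1]) auto
  then have "\<forall>\<^sub>F t in at_right 0. k (X t) > 0"
    using near[OF X] eventually_at_right_less[of 0]
  proof eventually_elim
    case (elim t)
    then have "X t \<in> \<Omega>" using z by (auto simp: X_def \<Omega>_def norm_mult simp del: of_real_diff)
    then show ?case using k_at elim by blast
  qed
  note X_pos = this
  have kX: "((\<lambda>t. k (X t)) has_real_derivative l n) (at_right 0)"
    by (rule k_deriv[OF X])
  \<comment> \<open>The graph condition does not state that the graph passes through the boundary
    point, that is \<open>h 0 = 0\<close>. It follows here: \<open>k (f z)\<close> is a limit of
    positive values along the radius, and it is not positive since \<open>f z\<close> lies outside
    the open image.\<close>
  have "((\<lambda>t. k (X t)) \<longlongrightarrow> k (X 0)) (at_right 0)"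
    using DERIV_continuous[OF kX] by (simp add: continuous_within)
  then have "k (X 0) \<ge> 0"
    by (rule tendsto_lowerbound) (use X_pos in \<open>auto elim: eventually_mono\<close>)
  moreover have "k (f z) \<le> 0" using k_at[of "f z"] r not_in[OF z] by auto
  ultimately have k0: "k (f z) = 0" using X(2) by simp
  have "((\<lambda>t. (k (X t) - k (X 0)) / (t - 0)) \<longlongrightarrow> l n) (at_right 0)"
    using kX by (simp add: has_field_derivative_iff)
  then have ln_ge: "l n \<ge> 0"
  proof (rule tendsto_lowerbound)
    show "\<forall>\<^sub>F t in at_right 0. 0 \<le> (k (X t) - k (X 0)) / (t - 0)"
      using X_pos eventually_at_right_less[of 0]
      by eventually_elim (use X k0 in simp)
  qed auto
  define \<theta> where "\<theta> = Arg z"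
  have cis: "cis \<theta> = z" using z cis_Arg[of z] by (cases "z = 0") (simp_all add: \<theta>_def sgn_eq)
  define Y where "Y = bdry_curve f"
  have Y: "(Y has_vector_derivative \<i> * (z * f' z)) (at \<theta>)" "Y \<theta> = f z"
    using curve_deriv[of \<theta>] by (auto simp: Y_def cis bdry_curve_def mult.assoc)
  have kY: "((\<lambda>t. k (Y t)) has_real_derivative l (\<i> * (z * f' z))) (at \<theta>)"
    by (rule k_deriv[OF Y])
  have "\<forall>\<^sub>F t in at \<theta>. k (Y t) \<le> 0"
    using near[OF Y]
  proof eventually_elim
    case (elim t)
    have "Y t \<notin> \<Omega>" unfolding Y_def bdry_curve_def by (rule not_in) simp
    then show ?case using k_at elim by force
  qed
  then obtain d where d: "d > 0" "\<And>t. t \<noteq> \<theta> \<Longrightarrow> dist t \<theta> < d \<Longrightarrow> k (Y t) \<le> 0"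
    unfolding eventually_at by auto
  have tan: "l (\<i> * (z * f' z)) = 0"
  proof (rule DERIV_local_max[OF kY d(1)])
    show "\<forall>y. \<bar>\<theta> - y\<bar> < d \<longrightarrow> k (Y y) \<le> k (Y \<theta>)"
    proof (intro allI impI)
      fix y assume "\<bar>\<theta> - y\<bar> < d"
      then show "k (Y y) \<le> k (Y \<theta>)"
        using d(2)[of y] k0 Y(2) by (cases "y = \<theta>") (auto simp: dist_real_def abs_minus_commute)
    qed
  qed
  \<comment> \<open>The radius yields only \<open>l n \<ge> 0\<close>. For strictness, the vanishing
    of \<open>l\<close> on the tangent, a quarter turn of \<open>n\<close>, forces
    \<open>Re q = - a * Im q\<close> and hence \<open>l n = (1 + a\<^sup>2) * Im q\<close>. If this
    were zero, \<open>q\<close> would be zero, contrary to \<open>f' z \<noteq> 0\<close>.\<close>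
  define a where "a = h' 0"
  define q where "q = n / \<tau>"
  have "q \<noteq> 0" using nz z \<tau> by (auto simp: q_def n_def)
  have "\<i> * (z * f' z) / \<tau> = - \<i> * q" by (simp add: q_def n_def)
  then have tan': "Re q = - a * Im q" using tan by (simp add: l_def a_def)
  have ln: "l n = (1 + a\<^sup>2) * Im q"
    using tan' by (simp add: l_def q_def[symmetric] a_def[symmetric] power2_eq_square algebra_simps)
  have "Im q \<noteq> 0" using \<open>q \<noteq> 0\<close> tan' by (auto simp: complex_eq_iff)
  moreover have "1 + a\<^sup>2 > 0" by (simp add: add_pos_nonneg)
  ultimately have pos: "l n > 0" using ln ln_ge by (metis mult_eq_0_iff order_le_less less_irrefl)
  define \<nu> where "\<nu> = - sgn (z * f' z)"
  define Z where "Z t = f z + of_real t * \<nu>" for t :: real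
  have n_\<nu>: "n = cmod n *\<^sub>R \<nu>" "cmod n > 0"
    using nz z by (auto simp: n_def \<nu>_def sgn_eq scaleR_conv_of_real)
  have "l n = cmod n * l \<nu>"
  proof -
    have "n / \<tau> = cmod n *\<^sub>R (\<nu> / \<tau>)"
      by (subst n_\<nu>(1)) (simp add: scaleR_conv_of_real)
    then show ?thesis by (simp add: l_def algebra_simps)
  qed
  then have "l \<nu> > 0" using pos n_\<nu>(2) by (simp add: zero_less_mult_iff)
  have Z: "(Z has_vector_derivative \<nu>) (at 0)" "Z 0 = f z"
    unfolding Z_def by (auto intro!: derivative_eq_intros simp: has_vector_derivative_def scaleR_conv_of_real)
  obtain d where d: "d > 0" "\<And>t. 0 < t \<Longrightarrow> t < d \<Longrightarrow> k (Z 0) < k (Z t)"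
    using DERIV_pos_inc_right[OF k_deriv[OF Z] \<open>l \<nu> > 0\<close>] by auto
  have "\<forall>\<^sub>F t in at_right 0. Z t \<in> ball (f z) r"
    using near[OF Z] by (simp add: eventually_at_split)
  moreover have "\<forall>\<^sub>F t in at_right 0. k (Z t) > 0"
    by (rule eventually_at_rightI[of 0 d]) (use d k0 Z in auto)
  ultimately have "\<forall>\<^sub>F t in at_right 0. Z t \<in> \<Omega>"
    by eventually_elim (use k_at in blast)
  then show ?thesis by (simp only: Z_def \<nu>_def \<Omega>_def)
qed


text \<open>Boundary points are included: \<open>g\<close> is continuous on the compact image, which
  allows the derivative to be inverted relative to that set.\<close>

lemma g_deriv:
  assumes z: "z \<in> cball 0 1" and nz: "f' z \<noteq> 0"
  shows "(g has_field_derivative 1 / f' z) (at (f z) within f ` cball 0 1)"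
  unfolding has_field_derivative_def
proof (rule has_derivative_inverse_within[where f' = "(*) (f' z)"])
  show "(f has_derivative (*) (f' z)) (at z within cball 0 1)"
    using der[OF z] by (simp add: has_field_derivative_def)
  show "continuous (at (f z) within f ` cball 0 1) g"
    using cont_g z by (auto simp: continuous_on_eq_continuous_within)
  show "linear ((*) (1 / f' z))" by (rule bounded_linear.linear[OF bounded_linear_mult_right])
  show "(*) (1 / f' z) \<circ> (*) (f' z) = id" using nz by (auto simp: fun_eq_iff)
qed (use z g_f in auto)

text \<open>Pulled back to the disc, the inner normal ray leaves \<open>z\<close> with velocity
  \<open>- z / cmod (f' z)\<close>, straight towards the centre. Hence the modulus of
  \<open>g\<close> decreases at rate \<open>1 / cmod (f' z)\<close>, and at modulus 1 the logarithm
  has slope 1.\<close>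

lemma green_normal_deriv:
  assumes z: "cmod z = 1" and nz: "f' z \<noteq> 0"
  shows "directional_deriv (point_source_solution (f ` ball 0 1) (f 0)) (- sgn (z * f' z)) (f z)
           = 1 / (2 * pi * cmod (f' z))"
proof -
  define \<nu> where "\<nu> = - sgn (z * f' z)"
  define Z where "Z t = f z + of_real t * \<nu>" for t :: real
  define u where "u = point_source_solution (f ` ball 0 1) (f 0)"
  obtain e where e: "e > 0" "\<And>t. 0 < t \<Longrightarrow> t < e \<Longrightarrow> Z t \<in> f ` ball 0 1"
    using interior_normal_points_inside[OF z nz] unfolding eventually_at_right_field Z_def \<nu>_def by auto
  define S where "S = {0..e / 2}"
  have Z0: "Z 0 = f z" by (simp add: Z_def)
  have Z_in: "Z ` S \<subseteq> f ` cball 0 1"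
  proof
    fix w assume "w \<in> Z ` S"
    then obtain t where "w = Z t" "t \<in> S" by blast
    then show "w \<in> f ` cball 0 1"
      using e(2)[of t] e(1) z Z0 by (cases "t = 0") (auto simp: S_def)
  qed
  have "(Z has_vector_derivative \<nu>) (at 0 within S)"
    unfolding Z_def by (auto intro!: derivative_eq_intros simp: has_vector_derivative_def scaleR_conv_of_real)
  moreover have "(g has_field_derivative 1 / f' z) (at (Z 0) within Z ` S)"
    unfolding Z0 by (rule DERIV_subset[OF g_deriv]) (use z nz Z_in in auto)
  ultimately have gZ: "(g \<circ> Z has_vector_derivative \<nu> * (1 / f' z)) (at 0 within S)"
    by (rule field_vector_diff_chain_within)
  have gZ0: "(g \<circ> Z) 0 = z" using Z0 g_f z by simp
  have "\<nu> = - (z * f' z) / cmod (f' z)"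
    using z by (simp add: \<nu>_def sgn_eq norm_mult)
  then have w: "\<nu> * (1 / f' z) = - z / cmod (f' z)" using nz by simp
  have "((\<lambda>t. norm ((g \<circ> Z) t)) has_derivative (\<lambda>t. (t *\<^sub>R (\<nu> * (1 / f' z))) \<bullet> sgn z)) (at 0 within S)"
  proof (rule has_derivative_in_compose[where f = "g \<circ> Z" and g = norm and g' = "\<lambda>v. v \<bullet> sgn z"])
    show "((g \<circ> Z) has_derivative (\<lambda>t. t *\<^sub>R (\<nu> * (1 / f' z)))) (at 0 within S)"
      using gZ by (simp add: has_vector_derivative_def)
    show "(norm has_derivative (\<lambda>v. v \<bullet> sgn z)) (at ((g \<circ> Z) 0) within (g \<circ> Z) ` S)"
      unfolding gZ0 by (rule has_derivative_at_withinI[OF has_derivative_norm]) (use z in auto)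
  qed
  then have "((\<lambda>t. cmod (g (Z t))) has_real_derivative (- z / cmod (f' z)) \<bullet> sgn z) (at 0 within S)"
    unfolding has_field_derivative_def w o_def by (rule has_derivative_eq_rhs) (simp add: fun_eq_iff)
  moreover have "sgn z = z" using z by (simp add: sgn_eq)
  moreover have "(- z / cmod (f' z)) \<bullet> z = - 1 / cmod (f' z)"
    using z by (simp add: inner_complex_def complex_norm_square power2_eq_square cmod_def field_simps)
       (simp flip: add_divide_distrib)
  ultimately have "((\<lambda>t. cmod (g (Z t))) has_real_derivative - 1 / cmod (f' z)) (at 0 within S)"
    by simp
  then have "((\<lambda>t. - ln (cmod (g (Z t))) / (2 * pi)) has_real_derivative 1 / (2 * pi * cmod (f' z))) (at 0 within S)"
    using gZ0 z nz by (auto intro!: derivative_eq_intros)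
  then have "((\<lambda>t. green (Z t)) has_real_derivative 1 / (2 * pi * cmod (f' z))) (at_right 0)"
    using e(1) by (simp add: green_def S_def at_within_Icc_at_right)
  then have "((\<lambda>t. (green (Z t) - green (Z 0)) / (t - 0)) \<longlongrightarrow> 1 / (2 * pi * cmod (f' z))) (at_right 0)"
    by (simp add: has_field_derivative_iff)
  \<comment> \<open>The chosen solution is determined on the closure minus the pole, and short
    normal segments stay there.\<close>
  moreover have "\<forall>\<^sub>F t in at_right 0. (green (Z t) - green (Z 0)) / (t - 0) = (u (Z t) - u (f z)) / t"
  proof -
    have f0: "isCont Z 0" unfolding Z_def by (intro continuous_intros)
    have "f 0 \<noteq> f z" using inj_onD[OF inj, of 0 z] z by auto
    moreover have "(Z \<longlongrightarrow> f z) (at_right 0)" using f0 Z0 by (simp add: isCont_def filterlim_at_split)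
    ultimately have "\<forall>\<^sub>F t in at_right 0. Z t \<noteq> f 0"
      using tendsto_imp_eventually_ne by metis
    moreover have "\<forall>\<^sub>F t in at_right 0. Z t \<in> f ` cball 0 1"
      by (rule eventually_at_rightI[of 0 e]) (use e in \<open>force+\<close>)
    ultimately show ?thesis
    proof eventually_elim
      case (elim t)
      then show ?case
        using point_source_solution_eq[of "Z t"] point_source_solution_eq[of "f z"] \<open>f 0 \<noteq> f z\<close> z Z0
        by (auto simp: u_def)
    qed
  qed
  ultimately have "((\<lambda>t. (u (Z t) - u (f z)) / t) \<longlongrightarrow> 1 / (2 * pi * cmod (f' z))) (at_right 0)"
    by (rule Lim_transform_eventually)
  then show ?thesis
    unfolding directional_deriv_def u_def[symmetric] \<nu>_def[symmetric] Z_def[symmetric]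
    by (rule tendsto_Lim[rotated]) simp
qed

lemma interior_normal_eq: "interior_normal f \<theta> = - sgn (cis \<theta> * f' (cis \<theta>))"
proof -
  have "vector_derivative (bdry_curve f) (at \<theta>) = \<i> * (cis \<theta> * f' (cis \<theta>))"
    using vector_derivative_at[OF curve_deriv] by (simp add: mult.assoc)
  moreover have "sgn \<i> = \<i>" by (simp add: sgn_eq)
  ultimately show ?thesis by (simp add: interior_normal_def sgn_mult)
qed

definition normal_deriv where
  "normal_deriv \<theta> = directional_deriv (point_source_solution (f ` ball 0 1) (f 0))
     (interior_normal f \<theta>) (bdry_curve f \<theta>)"

lemma normal_deriv_eq:
  "normal_deriv \<theta> = (if f' (cis \<theta>) = 0 then 0 else 1 / (2 * pi * cmod (f' (cis \<theta>))))"
proof (cases "f' (cis \<theta>) = 0")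
  case True
  then have "interior_normal f \<theta> = 0" by (simp add: interior_normal_eq)
  then show ?thesis
    using True by (simp add: normal_deriv_def directional_deriv_def tendsto_Lim)
next
  case False
  then show ?thesis
    using green_normal_deriv[of "cis \<theta>"] by (simp add: normal_deriv_def interior_normal_eq bdry_curve_def)
qed

section \<open>Arclength parametrization and the values of the operator T\<close>

definition speed where "speed \<theta> = cmod (f' (cis \<theta>))"

abbreviation "arclen \<equiv> bdry_arclength f"

lemma speed_continuous: "continuous_on S speed"
  unfolding speed_def
  by (intro continuous_on_norm continuous_on_compose2[OF cont'] continuous_intros) auto

lemma arclen_eq: "arclen \<theta> = integral {0..\<theta>} speed"
  unfolding bdry_arclength_def speed_def using vector_derivative_at[OF curve_deriv] by (simp add: norm_mult)

lemma arclen_0: "arclen 0 = 0"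
  by (simp add: arclen_eq)

lemma perimeter_eq: "perimeter f = arclen (2 * pi)"
  by (simp add: perimeter_def)

lemma arclen_deriv:
  assumes "\<theta> \<in> {0..b}"
  shows "(arclen has_real_derivative speed \<theta>) (at \<theta> within {0..b})"
  unfolding arclen_eq[abs_def] using integral_has_real_derivative[OF speed_continuous assms] .

lemma arclen_continuous: "continuous_on {0..b} arclen"
  using arclen_deriv by (meson DERIV_continuous_on)

text \<open>The speed is not yet known to be positive. If it vanished on a whole interval, the
  boundary curve would be constant there, contrary to injectivity.\<close>

lemma arclen_strict_mono:
  assumes "0 \<le> a" "a < b"
  shows "arclen a < arclen b"
proof -
  have "integral {0..a} speed + integral {a..b} speed = integral {0..b} speed"
    using assms by (intro Henstock_Kurzweil_Integration.integral_combine integrable_continuous_real speed_continuous) auto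
  moreover have "integral {a..b} speed \<noteq> 0"
  proof
    assume "integral {a..b} speed = 0"
    then have zero: "speed x = 0" if "x \<in> {a..b}" for x
      using that integral_eq_0_iff[OF speed_continuous \<open>a < b\<close>] by (auto simp: speed_def)
    \<comment> \<open>Staying within half a turn ensures that \<open>cis a\<close> and
      \<open>cis c\<close> are different points.\<close>
    define c where "c = min b (a + pi)"
    have c: "a < c" "c \<le> b" "c \<le> a + pi" using assms by (auto simp: c_def)
    obtain k where k: "\<And>x. x \<in> {a..c} \<Longrightarrow> bdry_curve f x = k"
    proof (rule has_vector_derivative_zero_constant[of "{a..c}" "bdry_curve f"])
      show "(bdry_curve f has_vector_derivative 0) (at x within {a..c})" if "x \<in> {a..c}" for x
        using has_vector_derivative_at_within[OF curve_deriv[of x]] zero[of x] that c by (simp add: speed_def)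
    qed (use that in auto)
    have "f (cis a) = f (cis c)" using k[of a] k[of c] c by (simp add: bdry_curve_def)
    then have "cis a = cis c" using inj_onD[OF inj, of "cis a" "cis c"] by simp
    then have "cis (c - a) = 1" by (simp add: cis_divide[symmetric])
    then have "cos (c - a) = 1" by (metis cis.simps(1) one_complex.simps(1))
    moreover have "cos (c - a) < cos 0" using c by (intro cos_monotone_0_pi) auto
    ultimately show False by simp
  qed
  moreover have "integral {a..b} speed \<ge> 0" by (rule integral_nonneg) (auto simp: speed_def intro!: integrable_continuous_real speed_continuous[unfolded speed_def[abs_def]])
  ultimately show ?thesis by (simp add: arclen_eq)
qed

lemma perimeter_pos: "perimeter f > 0"
  using arclen_strict_mono[of 0 "2 * pi"] arclen_0 by (simp add: perimeter_eq)

lemma arclen_surj: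
  assumes "x \<in> {0..perimeter f}"
  shows "\<exists>\<theta>\<in>{0..2 * pi}. arclen \<theta> = x"
  using IVT'[of arclen 0 x "2 * pi"] assms arclen_continuous arclen_0 by (auto simp: perimeter_eq)

text \<open>The definite description in \<open>T_op\<close> has to be justified. Arclength is a
  strictly increasing bijection from the angles in \<open>{0..2 * pi}\<close> onto one period, so
  the prescribed values determine a periodic function, and they are consistent because both ends of
  the period belong to the same boundary point.\<close>

lemma T_op_arclen:
  assumes "\<theta> \<in> {0..2 * pi}"
  shows "T_op f (arclen \<theta>) = normal_deriv \<theta>"
proof -
  define L where "L = perimeter f"
  have L: "L > 0" using perimeter_pos by (simp add: L_def)
  define R where "R \<phi> \<longleftrightarrow> (\<forall>s. \<phi> (s + L) = \<phi> s) \<and> (\<forall>\<theta>\<in>{0..2 * pi}. \<phi> (arclen \<theta>) = normal_deriv \<theta>)" for \<phi>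
  have per: "\<phi> (x - of_int n * L) = \<phi> x" if "\<forall>s. \<phi> (s + L) = \<phi> s" for \<phi> :: "real \<Rightarrow> real" and x n
  proof (induction n rule: int_induct[of _ 0])
    case (step1 i)
    then show ?case using that[rule_format, of "x - of_int (i + 1) * L"] by (simp add: algebra_simps)
  next
    case (step2 i)
    then show ?case using that[rule_format, of "x - of_int i * L"] by (simp add: algebra_simps)
  qed simp
  \<comment> \<open>Reduction modulo the perimeter into the half-open period.\<close>
  define red where "red x = x - of_int \<lfloor>x / L\<rfloor> * L" for x
  have red: "0 \<le> red x" "red x < L" for x
  proof -
    have "of_int \<lfloor>x / L\<rfloor> * L \<le> x / L * L" "x / L * L < (of_int \<lfloor>x / L\<rfloor> + 1) * L"
      using L by (intro mult_right_mono mult_strict_right_mono; linarith)+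
    then show "0 \<le> red x" "red x < L" using L by (simp_all add: red_def distrib_right)
  qed
  have inj_arc: "\<theta> = \<theta>'" if "arclen \<theta> = arclen \<theta>'" "0 \<le> \<theta>" "0 \<le> \<theta>'" for \<theta> \<theta>'
    using that arclen_strict_mono by (metis linorder_cases order_less_irrefl)
  define \<Theta> where "\<Theta> x = (SOME \<theta>. \<theta> \<in> {0..2 * pi} \<and> arclen \<theta> = x)" for x
  have \<Theta>: "\<Theta> x \<in> {0..2 * pi} \<and> arclen (\<Theta> x) = x" if "x \<in> {0..L}" for x
    unfolding \<Theta>_def by (rule someI_ex) (use arclen_surj[of x] that in \<open>simp add: L_def Bex_def\<close>)
  have \<Theta>_arclen: "\<Theta> (arclen \<theta>) = \<theta>" if "\<theta> \<in> {0..2 * pi}" for \<theta>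
  proof -
    have "arclen \<theta> \<in> {0..L}"
      using that arclen_strict_mono[of 0 \<theta>] arclen_strict_mono[of \<theta> "2 * pi"] arclen_0
      by (cases "\<theta> = 0"; cases "\<theta> = 2 * pi") (auto simp: L_def perimeter_eq)
    then show ?thesis using \<Theta> inj_arc that by auto
  qed
  have "R (\<lambda>x. normal_deriv (\<Theta> (red x)))"
    unfolding R_def
  proof (intro conjI allI ballI)
    fix s :: real
    have "(s + L) / L = s / L + of_int 1" using L by (simp add: field_simps)
    then have "red (s + L) = red s" by (simp only: red_def floor_add_int) (simp add: algebra_simps)
    then show "normal_deriv (\<Theta> (red (s + L))) = normal_deriv (\<Theta> (red s))" by simp
  next
    fix \<theta> :: real assume \<theta>: "\<theta> \<in> {0..2 * pi}"
    show "normal_deriv (\<Theta> (red (arclen \<theta>))) = normal_deriv \<theta>"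
    proof (cases "\<theta> = 2 * pi")
      \<comment> \<open>A full turn is reduced to arclength 0, so \<open>\<Theta>\<close> returns
        the angle 0 instead of \<open>2 * pi\<close>; the normal derivative depends on the angle
        through \<open>cis\<close> and is the same.\<close>
      case True
      then have "red (arclen \<theta>) = arclen 0" using L by (simp add: red_def L_def perimeter_eq arclen_0)
      then have "\<Theta> (red (arclen \<theta>)) = 0" using \<Theta>_arclen[of 0] by simp
      then show ?thesis using True by (simp add: normal_deriv_eq)
    next
      case False
      then have "0 \<le> arclen \<theta>" "arclen \<theta> < L"
        using \<theta> arclen_strict_mono[of 0 \<theta>] arclen_strict_mono[of \<theta> "2 * pi"] arclen_0
        by (cases "\<theta> = 0"; auto simp: L_def perimeter_eq)+
      then have "\<lfloor>arclen \<theta> / L\<rfloor> = 0" using L by (intro floor_unique) (auto simp: field_simps)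
      then have "red (arclen \<theta>) = arclen \<theta>" by (simp add: red_def)
      then show ?thesis using \<Theta>_arclen[OF \<theta>] by simp
    qed
  qed
  moreover have "\<phi> = (\<lambda>x. normal_deriv (\<Theta> (red x)))" if "R \<phi>" for \<phi>
  proof
    fix x
    have "\<phi> x = \<phi> (red x)" unfolding red_def using per that unfolding R_def by metis
    also have "\<dots> = normal_deriv (\<Theta> (red x))"
      using \<Theta>[of "red x"] red[of x] that unfolding R_def by (metis atLeastAtMost_iff less_imp_le)
    finally show "\<phi> x = normal_deriv (\<Theta> (red x))" .
  qed
  ultimately have "R (THE \<phi>. R \<phi>)" by (rule theI[of R])
  moreover have "T_op f = (THE \<phi>. R \<phi>)" by (simp add: T_op_def R_def normal_deriv_def L_def)
  ultimately have "R (T_op f)" by simp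
  then show ?thesis using assms by (simp add: R_def)
qed

lemma T_op_pos_imp:
  assumes "\<And>s. T_op f s > 0" "\<theta> \<in> {0..2 * pi}"
  shows speed_pos: "speed \<theta> > 0" and speed_eq: "speed \<theta> = 1 / (2 * pi * T_op f (arclen \<theta>))"
proof -
  have "normal_deriv \<theta> > 0" using assms(1)[of "arclen \<theta>"] T_op_arclen[OF assms(2)] by simp
  then have nz: "f' (cis \<theta>) \<noteq> 0" by (auto simp: normal_deriv_eq)
  then show "speed \<theta> > 0" by (simp add: speed_def)
  show "speed \<theta> = 1 / (2 * pi * T_op f (arclen \<theta>))"
    using nz by (simp add: T_op_arclen[OF assms(2)] normal_deriv_eq speed_def)
qed

end

section \<open>Dependence of the boundary speed on its profile\<close>

text \<open>
  A solution of \<open>2 \<pi> \<rho>(\<sigma>) \<sigma>' = 1\<close> with \<open>\<sigma> 0 = 0\<close> satisfies \<open>2 \<pi> X(\<sigma> \<theta>) = \<theta>\<close> for the primitive \<open>X\<close> of \<open>\<rho>\<close>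
  with \<open>X 0 = 0\<close>; hence no Gronwall argument is needed.
\<close>
lemma autonomous_solutions_close:
  fixes \<rho>\<^sub>1 \<rho>\<^sub>2 \<sigma>\<^sub>1 \<sigma>\<^sub>2 :: "real \<Rightarrow> real"
  assumes cont: "continuous_on {0..L} \<rho>\<^sub>1" "continuous_on {0..L} \<rho>\<^sub>2"
    and lower: "b > 0" "\<And>x. x \<in> {0..L} \<Longrightarrow> b \<le> \<rho>\<^sub>1 x" "\<And>x. x \<in> {0..L} \<Longrightarrow> b \<le> \<rho>\<^sub>2 x"
    and close: "\<And>x. x \<in> {0..L} \<Longrightarrow> \<bar>\<rho>\<^sub>1 x - \<rho>\<^sub>2 x\<bar> \<le> d"
    and \<sigma>\<^sub>1: "\<sigma>\<^sub>1 0 = 0" "\<And>\<theta>. \<theta> \<in> {0..T} \<Longrightarrow> \<sigma>\<^sub>1 \<theta> \<in> {0..L}"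
      "\<And>\<theta>. \<theta> \<in> {0..T} \<Longrightarrow> (\<sigma>\<^sub>1 has_real_derivative 1 / (2 * pi * \<rho>\<^sub>1 (\<sigma>\<^sub>1 \<theta>))) (at \<theta> within {0..T})"
    and \<sigma>\<^sub>2: "\<sigma>\<^sub>2 0 = 0" "\<And>\<theta>. \<theta> \<in> {0..T} \<Longrightarrow> \<sigma>\<^sub>2 \<theta> \<in> {0..L}"
      "\<And>\<theta>. \<theta> \<in> {0..T} \<Longrightarrow> (\<sigma>\<^sub>2 has_real_derivative 1 / (2 * pi * \<rho>\<^sub>2 (\<sigma>\<^sub>2 \<theta>))) (at \<theta> within {0..T})"
    and \<theta>: "\<theta> \<in> {0..T}"
  shows "\<bar>\<sigma>\<^sub>1 \<theta> - \<sigma>\<^sub>2 \<theta>\<bar> \<le> L * d / b"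
proof -
  have time: "integral {0..\<sigma> \<theta>} \<rho> = \<theta> / (2 * pi)"
    if cont: "continuous_on {0..L} \<rho>" and lower: "\<And>x. x \<in> {0..L} \<Longrightarrow> b \<le> \<rho> x"
      and \<sigma>: "\<sigma> 0 = 0" "\<And>\<theta>. \<theta> \<in> {0..T} \<Longrightarrow> \<sigma> \<theta> \<in> {0..L}"
        "\<And>\<theta>. \<theta> \<in> {0..T} \<Longrightarrow> (\<sigma> has_real_derivative 1 / (2 * pi * \<rho> (\<sigma> \<theta>))) (at \<theta> within {0..T})"
    for \<rho> \<sigma> :: "real \<Rightarrow> real"
  proof -
    define X where "X x = integral {0..x} \<rho>" for x
    have zero: "((\<lambda>t. X (\<sigma> t) - t / (2 * pi)) has_real_derivative 0) (at t within {0..T})" if t: "t \<in> {0..T}" for t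
    proof -
      have "(X has_real_derivative \<rho> (\<sigma> t)) (at (\<sigma> t) within \<sigma> ` {0..T})"
        unfolding X_def
        by (rule DERIV_subset[OF integral_has_real_derivative[OF cont \<sigma>(2)[OF t]]]) (use \<sigma>(2) in auto)
      from DERIV_image_chain[OF this \<sigma>(3)[OF t]]
      have "((\<lambda>t. X (\<sigma> t)) has_real_derivative 1 / (2 * pi)) (at t within {0..T})"
        using lower[OF \<sigma>(2)[OF t]] \<open>b > 0\<close> by (simp add: o_def)
      then show ?thesis by (auto intro!: derivative_eq_intros)
    qed
    obtain c where c: "\<forall>t\<in>{0..T}. X (\<sigma> t) - t / (2 * pi) = c"
      using has_field_derivative_zero_constant[OF convex_real_interval(5) zero] by blast
    from bspec[OF c, of \<theta>] bspec[OF c, of 0] have "X (\<sigma> \<theta>) - \<theta> / (2 * pi) = X (\<sigma> 0)" using \<theta> by simp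
    then show ?thesis by (simp add: \<sigma>(1) X_def)
  qed
  define X\<^sub>1 where "X\<^sub>1 x = integral {0..x} \<rho>\<^sub>1" for x
  define X\<^sub>2 where "X\<^sub>2 x = integral {0..x} \<rho>\<^sub>2" for x
  have X\<^sub>1: "(X\<^sub>1 has_real_derivative \<rho>\<^sub>1 x) (at x within {0..L})" if "x \<in> {0..L}" for x
    unfolding X\<^sub>1_def by (rule integral_has_real_derivative[OF cont(1) that])
  have X\<^sub>2: "(X\<^sub>2 has_real_derivative \<rho>\<^sub>2 x) (at x within {0..L})" if "x \<in> {0..L}" for x
    unfolding X\<^sub>2_def by (rule integral_has_real_derivative[OF cont(2) that])
  have "X\<^sub>1 (\<sigma>\<^sub>1 \<theta>) = \<theta> / (2 * pi)" unfolding X\<^sub>1_def by (rule time) (fact assms)+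
  moreover have "X\<^sub>2 (\<sigma>\<^sub>2 \<theta>) = \<theta> / (2 * pi)" unfolding X\<^sub>2_def by (rule time) (fact assms)+
  ultimately have eq: "X\<^sub>1 (\<sigma>\<^sub>1 \<theta>) = X\<^sub>2 (\<sigma>\<^sub>2 \<theta>)" by simp
  \<comment> \<open>Since \<open>\<rho>\<^sub>1\<close> is at least \<open>b\<close>, its primitive
    expands distances by that factor, so closeness of values gives closeness of arguments.\<close>
  have expand: "b * \<bar>x - y\<bar> \<le> \<bar>X\<^sub>1 x - X\<^sub>1 y\<bar>" if "x \<in> {0..L}" "y \<in> {0..L}" for x y
  proof -
    have *: "b * (v - u) \<le> X\<^sub>1 v - X\<^sub>1 u" if "u < v" "u \<in> {0..L}" "v \<in> {0..L}" for u v
    proof -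
      have "\<exists>z\<in>{u<..<v}. X\<^sub>1 v - X\<^sub>1 u = \<rho>\<^sub>1 z * (v - u)"
      proof (rule mvt_simple[OF \<open>u < v\<close>, of X\<^sub>1 "\<lambda>z h. \<rho>\<^sub>1 z * h"])
        fix z assume z: "u \<le> z" "z \<le> v"
        then show "(X\<^sub>1 has_derivative (\<lambda>h. \<rho>\<^sub>1 z * h)) (at z within {u..v})"
          using that has_derivative_subset[OF X\<^sub>1[of z, unfolded has_field_derivative_def], of "{u..v}"] by auto
      qed
      then show ?thesis using lower(2) that by (auto intro!: mult_right_mono)
    qed
    show ?thesis
      using *[of x y] *[of y x] that \<open>b > 0\<close> by (cases x y rule: linorder_cases) (auto simp: abs_if)
  qed
  \<comment> \<open>As \<open>X\<^sub>1 (\<sigma>\<^sub>1 \<theta>) = X\<^sub>2 (\<sigma>\<^sub>2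
    \<theta>)\<close>, the increment of \<open>X\<^sub>1\<close> between the two solutions is the
    gap between the two primitives at the single point
    \<open>\<sigma>\<^sub>2 \<theta>\<close>.\<close>
  have "\<bar>(X\<^sub>1 (\<sigma>\<^sub>2 \<theta>) - X\<^sub>2 (\<sigma>\<^sub>2 \<theta>)) - (X\<^sub>1 0 - X\<^sub>2 0)\<bar> \<le> d * \<bar>\<sigma>\<^sub>2 \<theta> - 0\<bar>"
    using field_differentiable_bound[of "{0..L}" "\<lambda>x. X\<^sub>1 x - X\<^sub>2 x" "\<lambda>x. \<rho>\<^sub>1 x - \<rho>\<^sub>2 x" d "\<sigma>\<^sub>2 \<theta>" 0]
      X\<^sub>1 X\<^sub>2 close \<sigma>\<^sub>2(2)[OF \<theta>]
    by (auto intro!: DERIV_diff)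
  then have "\<bar>X\<^sub>1 (\<sigma>\<^sub>2 \<theta>) - X\<^sub>2 (\<sigma>\<^sub>2 \<theta>)\<bar> \<le> d * \<sigma>\<^sub>2 \<theta>"
    using \<sigma>\<^sub>2(2)[OF \<theta>] by (simp add: X\<^sub>1_def X\<^sub>2_def)
  also have "\<dots> \<le> d * L"
    using \<sigma>\<^sub>2(2)[OF \<theta>] order_trans[OF abs_ge_zero close[of 0]] by (intro mult_left_mono) auto
  finally have "b * \<bar>\<sigma>\<^sub>1 \<theta> - \<sigma>\<^sub>2 \<theta>\<bar> \<le> d * L"
    using expand[OF \<sigma>\<^sub>1(2)[OF \<theta>] \<sigma>\<^sub>2(2)[OF \<theta>]] by (simp add: eq abs_minus_commute)
  then show ?thesis using \<open>b > 0\<close> by (simp add: field_simps)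
qed

section \<open>Quantitative comparison of two rescaled profiles\<close>

lemma abs_ln_diff_le:
  assumes "m > 0" "m \<le> a" "m \<le> (b::real)"
  shows "\<bar>ln a - ln b\<bar> \<le> \<bar>a - b\<bar> / m"
proof -
  have *: "ln x - ln y \<le> \<bar>x - y\<bar> / m" if "m \<le> x" "m \<le> y" for x y
  proof -
    have "ln (x / y) \<le> x / y - 1" using that \<open>m > 0\<close> by (intro ln_le_minus_one) auto
    also have "\<dots> = (x - y) / y" using that \<open>m > 0\<close> by (simp add: field_simps)
    also have "\<dots> \<le> \<bar>x - y\<bar> / m" using that \<open>m > 0\<close> by (intro frac_le) auto
    finally show ?thesis using that \<open>m > 0\<close> by (simp add: ln_div)
  qed
  show ?thesis using *[of a b] *[of b a] assms by (simp add: abs_le_iff abs_minus_commute)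
qed

text \<open>Both profiles live on one interval, with \<open>\<kappa>\<^sub>1\<close> and
  \<open>\<kappa>\<^sub>2\<close> the ratios of the perimeters to \<open>L\<close> and
  \<open>\<sigma>\<^sub>1\<close>, \<open>\<sigma>\<^sub>2\<close> the arclengths divided by them.
  The bounds \<open>2 * M\<close> and \<open>4 * M\<close> are what a bound \<open>M\<close> becomes
  after rescaling by a ratio of at most 2. The constants defined below use only \<alpha>,
  \<open>m\<close>, \<open>M\<close>, \<open>c\<close>, \<kappa> and \<open>P\<close>, so they can
  be named before any pair of maps is given.\<close>

locale normalized_pair =
  fixes \<alpha> m M c \<kappa> P L \<eta> \<delta> \<kappa>\<^sub>1 \<kappa>\<^sub>2 T :: real and \<psi>\<^sub>1 \<psi>\<^sub>2 \<psi>\<^sub>1' \<psi>\<^sub>2' \<sigma>\<^sub>1 \<sigma>\<^sub>2 :: "real \<Rightarrow> real"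
  assumes \<alpha>: "0 < \<alpha>" "\<alpha> < 1" and m: "m > 0" and M: "M > 0" and c: "c \<ge> 0" and \<kappa>: "\<kappa> > 0"
    and L: "0 < L" "L \<le> P"
    and \<kappa>\<^sub>1: "\<kappa> \<le> \<kappa>\<^sub>1" "\<kappa>\<^sub>1 \<le> 2" and \<kappa>\<^sub>2: "\<kappa> \<le> \<kappa>\<^sub>2" "\<kappa>\<^sub>2 \<le> 2"
    and \<eta>: "0 \<le> \<eta>" "\<eta> \<le> 3"
    and \<kappa>_close: "\<bar>\<kappa>\<^sub>1 - \<kappa>\<^sub>2\<bar> \<le> c * \<eta>"
    and \<psi>_close: "\<And>x. x \<in> {0..L} \<Longrightarrow> \<bar>\<psi>\<^sub>1 x - \<psi>\<^sub>2 x\<bar> \<le> M * \<eta>"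
    and \<psi>'_close: "\<And>x. x \<in> {0..L} \<Longrightarrow> \<bar>\<psi>\<^sub>1' x - \<psi>\<^sub>2' x\<bar> \<le> \<delta>"
    and \<psi>\<^sub>1: "\<And>x. x \<in> {0..L} \<Longrightarrow> (\<psi>\<^sub>1 has_real_derivative \<psi>\<^sub>1' x) (at x within {0..L})"
      "\<And>x. x \<in> {0..L} \<Longrightarrow> m \<le> \<psi>\<^sub>1 x" "\<And>x. x \<in> {0..L} \<Longrightarrow> \<psi>\<^sub>1 x \<le> M"
      "\<And>x. x \<in> {0..L} \<Longrightarrow> \<bar>\<psi>\<^sub>1' x\<bar> \<le> 2 * M"
    and \<psi>\<^sub>2: "\<And>x. x \<in> {0..L} \<Longrightarrow> (\<psi>\<^sub>2 has_real_derivative \<psi>\<^sub>2' x) (at x within {0..L})"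
      "\<And>x. x \<in> {0..L} \<Longrightarrow> m \<le> \<psi>\<^sub>2 x" "\<And>x. x \<in> {0..L} \<Longrightarrow> \<psi>\<^sub>2 x \<le> M"
      "\<And>x. x \<in> {0..L} \<Longrightarrow> \<bar>\<psi>\<^sub>2' x\<bar> \<le> 2 * M"
    and holder: "\<And>x y. x \<in> {0..L} \<Longrightarrow> y \<in> {0..L} \<Longrightarrow> \<bar>\<psi>\<^sub>2' x - \<psi>\<^sub>2' y\<bar> \<le> 4 * M * \<bar>x - y\<bar> powr \<alpha>"
    and \<sigma>\<^sub>1: "\<sigma>\<^sub>1 0 = 0" "\<And>\<theta>. \<theta> \<in> {0..T} \<Longrightarrow> \<sigma>\<^sub>1 \<theta> \<in> {0..L}"
      "\<And>\<theta>. \<theta> \<in> {0..T} \<Longrightarrow> (\<sigma>\<^sub>1 has_real_derivative 1 / (2 * pi * (\<kappa>\<^sub>1 * \<psi>\<^sub>1 (\<sigma>\<^sub>1 \<theta>)))) (at \<theta> within {0..T})"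
    and \<sigma>\<^sub>2: "\<sigma>\<^sub>2 0 = 0" "\<And>\<theta>. \<theta> \<in> {0..T} \<Longrightarrow> \<sigma>\<^sub>2 \<theta> \<in> {0..L}"
      "\<And>\<theta>. \<theta> \<in> {0..T} \<Longrightarrow> (\<sigma>\<^sub>2 has_real_derivative 1 / (2 * pi * (\<kappa>\<^sub>2 * \<psi>\<^sub>2 (\<sigma>\<^sub>2 \<theta>)))) (at \<theta> within {0..T})"
begin

text \<open>The factors of \<eta> in the successive differences: of the arclengths, of the profiles
  evaluated along them, and of the products \<open>\<kappa>\<^sub>i * \<psi>\<^sub>i\<^sup>2\<close>
  that occur as denominators in the derivative of \<open>v\<close>.\<close>

definition "A\<^sub>1 = P * ((c + 2) * M) / (\<kappa> * m)"
definition "A\<^sub>2 = M + 2 * M * A\<^sub>1"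
definition "A\<^sub>3 = c * M\<^sup>2 + 4 * M * A\<^sub>2"

lemma A_nonneg: "0 \<le> A\<^sub>1" "0 \<le> A\<^sub>2" "0 \<le> A\<^sub>3"
proof -
  show "0 \<le> A\<^sub>1" using L M c \<kappa> m by (simp add: A\<^sub>1_def)
  then show "0 \<le> A\<^sub>2" using M by (simp add: A\<^sub>2_def)
  then show "0 \<le> A\<^sub>3" using M c by (simp add: A\<^sub>3_def)
qed

lemma \<sigma>_close:
  assumes \<theta>: "\<theta> \<in> {0..T}"
  shows "\<bar>\<sigma>\<^sub>1 \<theta> - \<sigma>\<^sub>2 \<theta>\<bar> \<le> A\<^sub>1 * \<eta>"
proof -
  have "\<bar>\<sigma>\<^sub>1 \<theta> - \<sigma>\<^sub>2 \<theta>\<bar> \<le> L * ((c + 2) * M * \<eta>) / (\<kappa> * m)"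
  proof (rule autonomous_solutions_close[OF _ _ _ _ _ _ \<sigma>\<^sub>1 \<sigma>\<^sub>2 \<theta>])
    show "continuous_on {0..L} (\<lambda>x. \<kappa>\<^sub>1 * \<psi>\<^sub>1 x)" "continuous_on {0..L} (\<lambda>x. \<kappa>\<^sub>2 * \<psi>\<^sub>2 x)"
      by (intro continuous_on_mult continuous_on_const DERIV_continuous_on[OF \<psi>\<^sub>1(1)] DERIV_continuous_on[OF \<psi>\<^sub>2(1)]; assumption)+
    show "\<kappa> * m > 0" using \<kappa> m by simp
    fix x assume x: "x \<in> {0..L}"
    show "\<kappa> * m \<le> \<kappa>\<^sub>1 * \<psi>\<^sub>1 x" "\<kappa> * m \<le> \<kappa>\<^sub>2 * \<psi>\<^sub>2 x"
      using \<psi>\<^sub>1(2)[OF x] \<psi>\<^sub>2(2)[OF x] \<kappa>\<^sub>1 \<kappa>\<^sub>2 \<kappa> m by (auto intro!: mult_mono)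
    have "\<kappa>\<^sub>1 * \<psi>\<^sub>1 x - \<kappa>\<^sub>2 * \<psi>\<^sub>2 x = (\<kappa>\<^sub>1 - \<kappa>\<^sub>2) * \<psi>\<^sub>1 x + \<kappa>\<^sub>2 * (\<psi>\<^sub>1 x - \<psi>\<^sub>2 x)" by (simp add: algebra_simps)
    then have "\<bar>\<kappa>\<^sub>1 * \<psi>\<^sub>1 x - \<kappa>\<^sub>2 * \<psi>\<^sub>2 x\<bar> \<le> \<bar>\<kappa>\<^sub>1 - \<kappa>\<^sub>2\<bar> * \<bar>\<psi>\<^sub>1 x\<bar> + \<bar>\<kappa>\<^sub>2\<bar> * \<bar>\<psi>\<^sub>1 x - \<psi>\<^sub>2 x\<bar>"
      by (metis abs_mult abs_triangle_ineq)
    also have "\<dots> \<le> (c * \<eta>) * M + 2 * (M * \<eta>)"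
      using \<kappa>_close \<psi>_close[OF x] \<kappa>\<^sub>2 \<kappa> \<psi>\<^sub>1(2,3)[OF x] m c \<eta> by (intro add_mono mult_mono) auto
    finally show "\<bar>\<kappa>\<^sub>1 * \<psi>\<^sub>1 x - \<kappa>\<^sub>2 * \<psi>\<^sub>2 x\<bar> \<le> (c + 2) * M * \<eta>" by (simp add: algebra_simps)
  qed
  also have "\<dots> \<le> P * ((c + 2) * M * \<eta>) / (\<kappa> * m)"
    using L c M \<eta> \<kappa> m by (intro divide_right_mono mult_right_mono) auto
  finally show ?thesis by (simp add: A\<^sub>1_def)
qed

lemma \<psi>_\<sigma>_close:
  assumes \<theta>: "\<theta> \<in> {0..T}"
  shows "\<bar>\<psi>\<^sub>1 (\<sigma>\<^sub>1 \<theta>) - \<psi>\<^sub>2 (\<sigma>\<^sub>2 \<theta>)\<bar> \<le> A\<^sub>2 * \<eta>"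
proof -
  have "\<bar>\<psi>\<^sub>2 (\<sigma>\<^sub>1 \<theta>) - \<psi>\<^sub>2 (\<sigma>\<^sub>2 \<theta>)\<bar> \<le> 2 * M * \<bar>\<sigma>\<^sub>1 \<theta> - \<sigma>\<^sub>2 \<theta>\<bar>"
    using field_differentiable_bound[of "{0..L}" \<psi>\<^sub>2 \<psi>\<^sub>2' "2 * M"] \<psi>\<^sub>2(1,4) \<sigma>\<^sub>1(2)[OF \<theta>] \<sigma>\<^sub>2(2)[OF \<theta>] by simp
  also have "\<dots> \<le> 2 * M * (A\<^sub>1 * \<eta>)" using \<sigma>_close[OF \<theta>] M by (intro mult_left_mono) auto
  finally show ?thesis using \<psi>_close[OF \<sigma>\<^sub>1(2)[OF \<theta>]] by (simp add: A\<^sub>2_def algebra_simps)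
qed

text \<open>The boundary speed is \<open>1 / (2 * pi * \<psi>)\<close> along
  \<open>\<sigma>\<close>, so this is the difference of the logarithms of the speeds; taking
  reciprocals reverses the order of the indices.\<close>

definition "v \<theta> = ln (\<psi>\<^sub>2 (\<sigma>\<^sub>2 \<theta>)) - ln (\<psi>\<^sub>1 (\<sigma>\<^sub>1 \<theta>))"

text \<open>The a priori bound \<eta> \<le> 3 lets every linear error be charged to the Hoelder
  term.\<close>

lemma \<eta>_le: "\<eta> \<le> 3 * \<eta> powr \<alpha>"
proof (cases "\<eta> = 0")
  case False
  then have "\<eta> > 0" using \<eta> by simp
  have "\<eta> powr (1 - \<alpha>) \<le> 3 powr (1 - \<alpha>)" using \<eta> \<alpha> by (intro powr_mono2) auto
  also have "\<dots> \<le> 3 powr 1" using \<alpha> by (intro powr_mono) auto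
  finally have "\<eta> powr \<alpha> * \<eta> powr (1 - \<alpha>) \<le> \<eta> powr \<alpha> * 3" by (intro mult_left_mono) auto
  then show ?thesis using \<open>\<eta> > 0\<close> by (simp flip: powr_add add: mult.commute)
qed simp

lemma v_bound:
  assumes \<theta>: "\<theta> \<in> {0..T}"
  shows "\<bar>v \<theta>\<bar> \<le> 3 * A\<^sub>2 / m * \<eta> powr \<alpha>"
proof -
  have "\<bar>v \<theta>\<bar> \<le> \<bar>\<psi>\<^sub>2 (\<sigma>\<^sub>2 \<theta>) - \<psi>\<^sub>1 (\<sigma>\<^sub>1 \<theta>)\<bar> / m"
    unfolding v_def using \<psi>\<^sub>1(2)[OF \<sigma>\<^sub>1(2)[OF \<theta>]] \<psi>\<^sub>2(2)[OF \<sigma>\<^sub>2(2)[OF \<theta>]] m by (intro abs_ln_diff_le)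
  also have "\<dots> \<le> A\<^sub>2 * (3 * \<eta> powr \<alpha>) / m"
    using \<psi>_\<sigma>_close[OF \<theta>] m A_nonneg \<eta>_le mult_left_mono[OF \<eta>_le A_nonneg(2)]
    by (intro divide_right_mono) (auto simp: abs_minus_commute)
  finally show ?thesis by (simp add: mult_ac)
qed

text \<open>The summands belong, in this order, to the difference of the profile derivatives at one
  point, to the Hoelder shift of the evaluation point, and to the change of the denominator.\<close>

definition "C\<^sub>1 = 1 / (\<kappa> * m\<^sup>2) + 4 * M * A\<^sub>1 powr \<alpha> / (\<kappa> * m\<^sup>2) + 6 * M * A\<^sub>3 / (\<kappa> * m\<^sup>2)\<^sup>2"

lemma C\<^sub>1_nonneg: "0 \<le> C\<^sub>1"
  using A_nonneg M \<kappa> by (simp add: C\<^sub>1_def)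

text \<open>By the differential equation for \<open>\<sigma>\<close>, the logarithmic derivative of
  \<open>\<psi>\<close> along \<open>\<sigma>\<close> is
  \<open>\<psi>' / (2 * pi * \<kappa> * \<psi>\<^sup>2)\<close>, with no derivative of
  \<open>\<sigma>\<close> left. The difference of two such quotients is split into numerators and
  denominators.\<close>

lemma v_deriv:
  assumes \<theta>: "\<theta> \<in> {0..T}"
  shows "\<exists>w. (v has_real_derivative w) (at \<theta> within {0..T}) \<and> \<bar>w\<bar> \<le> C\<^sub>1 * (\<eta> powr \<alpha> + \<delta>)"
proof -
  define y\<^sub>1 y\<^sub>2 N\<^sub>1 N\<^sub>2 where "y\<^sub>1 = \<psi>\<^sub>1 (\<sigma>\<^sub>1 \<theta>)" and "y\<^sub>2 = \<psi>\<^sub>2 (\<sigma>\<^sub>2 \<theta>)"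
    and "N\<^sub>1 = \<psi>\<^sub>1' (\<sigma>\<^sub>1 \<theta>)" and "N\<^sub>2 = \<psi>\<^sub>2' (\<sigma>\<^sub>2 \<theta>)"
  note s = \<sigma>\<^sub>1(2)[OF \<theta>] \<sigma>\<^sub>2(2)[OF \<theta>]
  have y: "m \<le> y\<^sub>1" "y\<^sub>1 \<le> M" "m \<le> y\<^sub>2" "y\<^sub>2 \<le> M"
    using \<psi>\<^sub>1(2,3)[OF s(1)] \<psi>\<^sub>2(2,3)[OF s(2)] by (auto simp: y\<^sub>1_def y\<^sub>2_def)
  define D\<^sub>1 D\<^sub>2 where "D\<^sub>1 = \<kappa>\<^sub>1 * y\<^sub>1\<^sup>2" and "D\<^sub>2 = \<kappa>\<^sub>2 * y\<^sub>2\<^sup>2"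
  have chain: "((\<lambda>t. ln (\<psi> (\<sigma> t))) has_real_derivative \<psi>' / (2 * pi * (k * (\<psi> (\<sigma> \<theta>))\<^sup>2))) (at \<theta> within {0..T})"
    if "(\<psi> has_real_derivative \<psi>') (at (\<sigma> \<theta>) within {0..L})" "\<sigma> ` {0..T} \<subseteq> {0..L}"
      "(\<sigma> has_real_derivative 1 / (2 * pi * (k * \<psi> (\<sigma> \<theta>)))) (at \<theta> within {0..T})" "\<psi> (\<sigma> \<theta>) > 0"
    for \<psi> \<sigma> :: "real \<Rightarrow> real" and \<psi>' k
  proof -
    have "(ln has_real_derivative 1 / \<psi> (\<sigma> \<theta>)) (at (\<psi> (\<sigma> \<theta>)))" using that(4) by (rule DERIV_ln_divide)
    moreover have "((\<lambda>t. \<psi> (\<sigma> t)) has_real_derivative \<psi>' * (1 / (2 * pi * (k * \<psi> (\<sigma> \<theta>))))) (at \<theta> within {0..T})"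
      using DERIV_image_chain[OF DERIV_subset[OF that(1,2)] that(3)] by (simp add: o_def)
    ultimately have "((\<lambda>t. ln (\<psi> (\<sigma> t))) has_real_derivative
        1 / \<psi> (\<sigma> \<theta>) * (\<psi>' * (1 / (2 * pi * (k * \<psi> (\<sigma> \<theta>)))))) (at \<theta> within {0..T})"
      by (rule DERIV_chain2)
    then show ?thesis by (simp add: power2_eq_square mult_ac)
  qed
  have "((\<lambda>t. ln (\<psi>\<^sub>1 (\<sigma>\<^sub>1 t))) has_real_derivative N\<^sub>1 / (2 * pi * D\<^sub>1)) (at \<theta> within {0..T})"
    unfolding N\<^sub>1_def D\<^sub>1_def y\<^sub>1_def
  proof (rule chain[OF \<psi>\<^sub>1(1)[OF s(1)] _ \<sigma>\<^sub>1(3)[OF \<theta>]])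
    show "0 < \<psi>\<^sub>1 (\<sigma>\<^sub>1 \<theta>)" using y m by (simp add: y\<^sub>1_def)
  qed (use \<sigma>\<^sub>1(2) in blast)
  moreover have "((\<lambda>t. ln (\<psi>\<^sub>2 (\<sigma>\<^sub>2 t))) has_real_derivative N\<^sub>2 / (2 * pi * D\<^sub>2)) (at \<theta> within {0..T})"
    unfolding N\<^sub>2_def D\<^sub>2_def y\<^sub>2_def
  proof (rule chain[OF \<psi>\<^sub>2(1)[OF s(2)] _ \<sigma>\<^sub>2(3)[OF \<theta>]])
    show "0 < \<psi>\<^sub>2 (\<sigma>\<^sub>2 \<theta>)" using y m by (simp add: y\<^sub>2_def)
  qed (use \<sigma>\<^sub>2(2) in blast)
  ultimately have "(v has_real_derivative N\<^sub>2 / (2 * pi * D\<^sub>2) - N\<^sub>1 / (2 * pi * D\<^sub>1)) (at \<theta> within {0..T})"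
    unfolding v_def[abs_def] by (intro DERIV_diff)
  moreover have "\<bar>N\<^sub>2 / (2 * pi * D\<^sub>2) - N\<^sub>1 / (2 * pi * D\<^sub>1)\<bar> \<le> C\<^sub>1 * (\<eta> powr \<alpha> + \<delta>)"
  proof -
    define q where "q = \<kappa> * m\<^sup>2"
    have q: "q > 0" using \<kappa> m by (simp add: q_def)
    have D: "q \<le> D\<^sub>1" "q \<le> D\<^sub>2"
      using y m \<kappa>\<^sub>1 \<kappa>\<^sub>2 \<kappa> by (auto simp: q_def D\<^sub>1_def D\<^sub>2_def intro!: mult_mono power_mono)
    \<comment> \<open>The comparison goes through \<open>\<psi>\<^sub>2'\<close> at the first
      arclength. The second term moves the evaluation point, and it alone produces a fractional
      power of \<eta>.\<close>
    have "\<bar>N\<^sub>2 - N\<^sub>1\<bar> \<le> \<bar>\<psi>\<^sub>1' (\<sigma>\<^sub>1 \<theta>) - \<psi>\<^sub>2' (\<sigma>\<^sub>1 \<theta>)\<bar> + \<bar>\<psi>\<^sub>2' (\<sigma>\<^sub>1 \<theta>) - \<psi>\<^sub>2' (\<sigma>\<^sub>2 \<theta>)\<bar>"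
      by (simp add: N\<^sub>1_def N\<^sub>2_def)
    also have "\<dots> \<le> \<delta> + 4 * M * \<bar>\<sigma>\<^sub>1 \<theta> - \<sigma>\<^sub>2 \<theta>\<bar> powr \<alpha>"
      using \<psi>'_close[OF s(1)] holder[OF s] by simp
    also have "\<dots> \<le> \<delta> + 4 * M * (A\<^sub>1 * \<eta>) powr \<alpha>"
      using M \<alpha> \<sigma>_close[OF \<theta>] by (intro add_left_mono mult_left_mono powr_mono2) auto
    finally have N: "\<bar>N\<^sub>2 - N\<^sub>1\<bar> \<le> \<delta> + 4 * M * (A\<^sub>1 powr \<alpha> * \<eta> powr \<alpha>)"
      using A_nonneg \<eta> by (simp add: powr_mult)
    have N\<^sub>1: "\<bar>N\<^sub>1\<bar> \<le> 2 * M" using \<psi>\<^sub>1(4)[OF s(1)] by (simp add: N\<^sub>1_def)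
    have "D\<^sub>1 - D\<^sub>2 = (\<kappa>\<^sub>1 - \<kappa>\<^sub>2) * y\<^sub>1\<^sup>2 + \<kappa>\<^sub>2 * ((y\<^sub>1 + y\<^sub>2) * (y\<^sub>1 - y\<^sub>2))"
      by (simp add: D\<^sub>1_def D\<^sub>2_def algebra_simps power2_eq_square)
    then have "\<bar>D\<^sub>1 - D\<^sub>2\<bar> \<le> \<bar>\<kappa>\<^sub>1 - \<kappa>\<^sub>2\<bar> * \<bar>y\<^sub>1\<^sup>2\<bar> + \<bar>\<kappa>\<^sub>2\<bar> * (\<bar>y\<^sub>1 + y\<^sub>2\<bar> * \<bar>y\<^sub>1 - y\<^sub>2\<bar>)"
      by (metis abs_mult abs_triangle_ineq)
    also have "\<dots> \<le> (c * \<eta>) * M\<^sup>2 + 2 * ((2 * M) * (A\<^sub>2 * \<eta>))"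
      using \<kappa>_close \<kappa>\<^sub>2 \<kappa> y m c \<eta> M A_nonneg \<psi>_\<sigma>_close[OF \<theta>]
      by (intro add_mono mult_mono) (auto simp: y\<^sub>1_def y\<^sub>2_def intro!: power_mono mult_nonneg_nonneg)
    finally have DD: "\<bar>D\<^sub>1 - D\<^sub>2\<bar> \<le> A\<^sub>3 * \<eta>" by (simp add: A\<^sub>3_def algebra_simps)
    have "N\<^sub>2 / (2 * pi * D\<^sub>2) - N\<^sub>1 / (2 * pi * D\<^sub>1) = ((N\<^sub>2 - N\<^sub>1) / D\<^sub>2 + N\<^sub>1 * (D\<^sub>1 - D\<^sub>2) / (D\<^sub>1 * D\<^sub>2)) / (2 * pi)"
      using D q by (simp add: field_simps)
    then have "\<bar>N\<^sub>2 / (2 * pi * D\<^sub>2) - N\<^sub>1 / (2 * pi * D\<^sub>1)\<bar>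
      = \<bar>(N\<^sub>2 - N\<^sub>1) / D\<^sub>2 + N\<^sub>1 * (D\<^sub>1 - D\<^sub>2) / (D\<^sub>1 * D\<^sub>2)\<bar> / (2 * pi)" by simp
    also have "\<dots> \<le> \<bar>(N\<^sub>2 - N\<^sub>1) / D\<^sub>2 + N\<^sub>1 * (D\<^sub>1 - D\<^sub>2) / (D\<^sub>1 * D\<^sub>2)\<bar> / 1"
      using pi_gt3 by (intro divide_left_mono) auto
    also have "\<dots> \<le> \<bar>N\<^sub>2 - N\<^sub>1\<bar> / D\<^sub>2 + \<bar>N\<^sub>1\<bar> * \<bar>D\<^sub>1 - D\<^sub>2\<bar> / (D\<^sub>1 * D\<^sub>2)"
      using D q abs_triangle_ineq[of "(N\<^sub>2 - N\<^sub>1) / D\<^sub>2" "N\<^sub>1 * (D\<^sub>1 - D\<^sub>2) / (D\<^sub>1 * D\<^sub>2)"] by (simp add: abs_mult)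
    also have "\<dots> \<le> (\<delta> + 4 * M * (A\<^sub>1 powr \<alpha> * \<eta> powr \<alpha>)) / q + (2 * M) * (A\<^sub>3 * \<eta>) / (q * q)"
      using N N\<^sub>1 DD D q M by (intro add_mono frac_le mult_mono) auto
    also have "\<dots> \<le> (\<delta> + 4 * M * (A\<^sub>1 powr \<alpha> * \<eta> powr \<alpha>)) / q + (2 * M) * (A\<^sub>3 * (3 * \<eta> powr \<alpha>)) / (q * q)"
      using q M A_nonneg \<eta>_le by (intro add_left_mono divide_right_mono mult_left_mono) auto
    also have "\<dots> = 1 / q * \<delta> + (4 * M * A\<^sub>1 powr \<alpha> / q + 6 * M * A\<^sub>3 / q\<^sup>2) * \<eta> powr \<alpha>"
      by (simp add: add_divide_distrib distrib_right power2_eq_square)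
    also have "\<dots> \<le> C\<^sub>1 * \<delta> + C\<^sub>1 * \<eta> powr \<alpha>"
    proof (intro add_mono mult_right_mono)
      show "1 / q \<le> C\<^sub>1" "4 * M * A\<^sub>1 powr \<alpha> / q + 6 * M * A\<^sub>3 / q\<^sup>2 \<le> C\<^sub>1"
        using q M A_nonneg by (simp_all add: C\<^sub>1_def flip: q_def)
      show "0 \<le> \<delta>" using order_trans[OF abs_ge_zero \<psi>'_close[OF s(1)]] .
    qed simp
    finally show ?thesis by (simp add: distrib_left add.commute)
  qed
  ultimately show ?thesis by blast
qed

lemma v_lipschitz:
  assumes "a \<in> {0..T}" "b \<in> {0..T}"
  shows "\<bar>v a - v b\<bar> \<le> C\<^sub>1 * (\<eta> powr \<alpha> + \<delta>) * \<bar>a - b\<bar>"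
proof -
  obtain w where "\<And>\<theta>. \<theta> \<in> {0..T} \<Longrightarrow> (v has_real_derivative w \<theta>) (at \<theta> within {0..T}) \<and> \<bar>w \<theta>\<bar> \<le> C\<^sub>1 * (\<eta> powr \<alpha> + \<delta>)"
    using v_deriv by metis
  then show ?thesis
    using field_differentiable_bound[of "{0..T}" v w "C\<^sub>1 * (\<eta> powr \<alpha> + \<delta>)" a b] assms by simp
qed

end

section \<open>The stability estimate\<close>

text \<open>The derivative within the closed disc is unique because the disc is connected with more
  than one point, so none of its points is isolated.\<close>

lemma cdisc_deriv_eq:
  assumes "(F has_field_derivative d) (at z within cball 0 1)" "z \<in> cball 0 1"
  shows "cdisc_deriv F z = d"
  unfolding cdisc_deriv_def
proof (rule the_equality)
  show "(F has_field_derivative d) (at z within cball 0 1)" by fact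
  fix e assume "(F has_field_derivative e) (at z within cball 0 1)"
  moreover have "\<not> trivial_limit (at z within cball 0 1)"
  proof -
    have "cball 0 1 \<noteq> {w}" for w :: complex
    proof
      assume "cball 0 1 = {w}"
      moreover have "(0 :: complex) \<in> cball 0 1" "(1 :: complex) \<in> cball 0 1" by simp_all
      ultimately have "(0 :: complex) = 1" by (metis singletonD)
      then show False by simp
    qed
    then show ?thesis
      unfolding trivial_limit_within using connected_imp_perfect[OF connected_cball assms(2)] by auto
  qed
  ultimately show "e = d"
    using assms(1) unfolding has_field_derivative_iff by (meson tendsto_unique)
qed

lemma unit_circle_polar:
  assumes "cmod z = 1"
  shows "\<exists>\<theta>\<in>{0..<2 * pi}. z = cis \<theta>"
  using assms Arg2pi_ge_0[of z] Arg2pi_lt_2pi[of z] complex_norm_eq_1_exp[of z]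
  by (auto intro!: bexI[of _ "Arg2pi z"] simp: cis_conv_exp)

text \<open>Everything follows from
  \<open>c * f\<^sub>1' - f\<^sub>2' = f\<^sub>2' * (Q - 1)\<close>. The bound \<open>S\<close>
  extends from the circle to the disc by the maximum principle, and the factor 2 counts the two
  suprema in the norm.\<close>

lemma disc_maps_close:
  assumes "disc_map \<alpha> f\<^sub>1 f\<^sub>1'" and "disc_map \<alpha> f\<^sub>2 f\<^sub>2'" and f0: "f\<^sub>1 0 = \<zeta>" "f\<^sub>2 0 = \<zeta>"
    and nz: "\<And>z. cmod z = 1 \<Longrightarrow> f\<^sub>1' z \<noteq> 0" "\<And>z. cmod z = 1 \<Longrightarrow> f\<^sub>2' z \<noteq> 0"
    and V: "\<And>\<theta>. \<theta> \<in> {0..2 * pi} \<Longrightarrow> V \<theta> = ln (cmod (f\<^sub>1' (cis \<theta>))) - ln (cmod (f\<^sub>2' (cis \<theta>)))"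
    and bound: "\<And>\<theta>. \<theta> \<in> {0..2 * pi} \<Longrightarrow> \<bar>V \<theta>\<bar> \<le> B"
    and lip: "\<And>a b. a \<in> {0..2 * pi} \<Longrightarrow> b \<in> {0..2 * pi} \<Longrightarrow> \<bar>V a - V b\<bar> \<le> \<Lambda> * \<bar>a - b\<bar>"
    and S: "\<And>z. cmod z = 1 \<Longrightarrow> cmod (f\<^sub>2' z) \<le> S"
  defines "X \<equiv> B + 8 * exp 2 * \<Lambda>"
  shows "\<exists>c. cmod c = 1 \<and> C1_norm_circle (\<lambda>z. (\<zeta> + c * (f\<^sub>1 z - \<zeta>)) - f\<^sub>2 z) \<le> 2 * (S * (X * exp X))"
proof -
  interpret f1: disc_map \<alpha> f\<^sub>1 f\<^sub>1' by fact
  interpret f2: disc_map \<alpha> f\<^sub>2 f\<^sub>2' by fact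
  have nz': "f\<^sub>1' z \<noteq> 0" "f\<^sub>2' z \<noteq> 0" if "z \<in> cball 0 1" for z
    using that nz[of z] f1.f'_ball_nonzero[of z] f2.f'_ball_nonzero[of z] by (cases "cmod z = 1"; auto)+
  define q where "q = f\<^sub>1' 0 / f\<^sub>2' 0"
  have "q \<noteq> 0" using nz' by (simp add: q_def)
  \<comment> \<open>The rotation that makes \<open>Q 0\<close> real and positive.\<close>
  define c where "c = cmod q / q"
  have c: "cmod c = 1" "c * q = cmod q" using \<open>q \<noteq> 0\<close> by (simp_all add: c_def norm_divide)
  define Q where "Q z = c * f\<^sub>1' z / f\<^sub>2' z" for z
  have Q0: "Q 0 = cmod q" using c(2) by (simp add: Q_def q_def)
  have ln_Q: "ln (cmod (Q (cis \<theta>))) = V \<theta>" if "\<theta> \<in> {0..2 * pi}" for \<theta>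
    using nz[of "cis \<theta>"] c(1) by (simp add: Q_def V[OF that] norm_mult norm_divide ln_div)
  have Q_bound: "cmod (Q z - 1) \<le> X * exp X" if z: "z \<in> cball 0 1" for z
    unfolding X_def
  proof (rule norm_minus_one_le_if_angular_log_lipschitz[OF _ _ _ _ _ _ _ z])
    show "Q holomorphic_on ball 0 1"
      unfolding Q_def[abs_def] using nz' f1.f'_holomorphic f2.f'_holomorphic by (intro holomorphic_intros) auto
    show "continuous_on (cball 0 1) Q"
      unfolding Q_def[abs_def] using nz' f1.cont' f2.cont' by (intro continuous_intros) auto
    show "Q z \<noteq> 0" if "z \<in> cball 0 1" for z
      using nz'[OF that] c(1) by (auto simp: Q_def)
    show "Q 0 \<in> \<real>" "Re (Q 0) > 0" using Q0 \<open>q \<noteq> 0\<close> by simp_all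
    show "\<bar>ln (cmod (Q z))\<bar> \<le> B" if z: "cmod z = 1" for z
    proof -
      obtain \<theta> where "\<theta> \<in> {0..<2 * pi}" "z = cis \<theta>" using unit_circle_polar[OF z] by blast
      then show ?thesis using bound[of \<theta>] ln_Q[of \<theta>] by simp
    qed
    fix z h assume z: "cmod z = 1" and h: "0 < h" "h < (1::real)"
    obtain \<theta> where \<theta>: "\<theta> \<in> {0..<2 * pi}" "z = cis \<theta>" using unit_circle_polar[OF z] by blast
    have zh: "z * cis h = cis (\<theta> + h)" by (simp add: \<theta> cis_mult)
    show "\<bar>ln (cmod (Q (z * cis h))) - ln (cmod (Q z))\<bar> \<le> \<Lambda> * h"
    proof (cases "\<theta> + h \<le> 2 * pi")
      case True
      then show ?thesis
        using lip[of "\<theta> + h" \<theta>] \<theta> h ln_Q[of \<theta>] ln_Q[of "\<theta> + h"] zh by simp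
    next
      case False
      \<comment> \<open>The arc from \<open>z\<close> to \<open>z * cis h\<close> crosses the angle
        0. It is cut there; the two pieces have total length \<open>h\<close>, and \<open>V\<close>
        agrees at 0 and \<open>2 * pi\<close>.\<close>
      define \<theta>' where "\<theta>' = \<theta> + h - 2 * pi"
      have \<theta>': "\<theta>' \<in> {0..2 * pi}" using False \<theta> h pi_gt3 by (auto simp: \<theta>'_def)
      have "cis (\<theta> + h) = cis \<theta>' * cis (2 * pi)" unfolding cis_mult \<theta>'_def by simp
      then have "z * cis h = cis \<theta>'" using zh by simp
      moreover have "V (2 * pi) = V 0" using V[of "2 * pi"] V[of 0] by simp
      ultimately have "\<bar>ln (cmod (Q (z * cis h))) - ln (cmod (Q z))\<bar> \<le> \<bar>V \<theta>' - V 0\<bar> + \<bar>V (2 * pi) - V \<theta>\<bar>"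
        using ln_Q[OF \<theta>'] ln_Q[of \<theta>] \<theta> by simp
      also have "\<dots> \<le> \<Lambda> * \<bar>\<theta>' - 0\<bar> + \<Lambda> * \<bar>2 * pi - \<theta>\<bar>"
        using \<theta> \<theta>' by (intro add_mono lip) auto
      also have "\<dots> = \<Lambda> * h" using \<theta> \<theta>' by (simp add: \<theta>'_def algebra_simps)
      finally show ?thesis .
    qed
  qed
  have S': "cmod (f\<^sub>2' z) \<le> S" if "z \<in> cball 0 1" for z
  proof (rule maximum_modulus_frontier[of f\<^sub>2' "cball 0 1" S])
    show "f\<^sub>2' holomorphic_on interior (cball 0 1)" using f2.f'_holomorphic by simp
    show "continuous_on (closure (cball 0 1)) f\<^sub>2'" using f2.cont' by simp
    show "cmod (f\<^sub>2' w) \<le> S" if "w \<in> frontier (cball 0 1)" for w using that S by simp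
  qed (use that in auto)
  define K where "K = S * (X * exp X)"
  have d_bound: "cmod (c * f\<^sub>1' z - f\<^sub>2' z) \<le> K" if z: "z \<in> cball 0 1" for z
  proof -
    have "c * f\<^sub>1' z - f\<^sub>2' z = f\<^sub>2' z * (Q z - 1)"
      using nz'[OF z] by (simp add: Q_def field_simps)
    then show ?thesis
      using mult_mono[OF S'[OF z] Q_bound[OF z]] order_trans[OF norm_ge_zero S'[OF z]]
      by (simp add: norm_mult K_def)
  qed
  define F where "F z = (\<zeta> + c * (f\<^sub>1 z - \<zeta>)) - f\<^sub>2 z" for z
  have F': "(F has_field_derivative (c * f\<^sub>1' z - f\<^sub>2' z)) (at z within cball 0 1)" if "z \<in> cball 0 1" for z
    unfolding F_def[abs_def] using f1.der[OF that] f2.der[OF that] by (auto intro!: derivative_eq_intros)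
  \<comment> \<open>Both maps send 0 to \<open>\<zeta>\<close>, so \<open>F 0 = 0\<close>, and
    integrating over a radius of length 1 preserves the bound.\<close>
  have F_bound: "cmod (F z) \<le> K" if "z \<in> sphere 0 1" for z
    using field_differentiable_bound[OF convex_cball F' d_bound, of z 0] that f0 by (simp add: F_def)
  have "C1_norm_circle F \<le> K + K"
    unfolding C1_norm_circle_def
  proof (intro add_mono cSUP_least)
    show "sphere 0 1 \<noteq> ({} :: complex set)" "sphere 0 1 \<noteq> ({} :: complex set)" by auto
    fix z :: complex assume z: "z \<in> sphere 0 1"
    show "cmod (F z) \<le> K" by (rule F_bound[OF z])
    show "cmod (cdisc_deriv F z) \<le> K"
      using cdisc_deriv_eq[OF F'] d_bound[of z] z by simp
  qed
  then have "C1_norm_circle (\<lambda>z. (\<zeta> + c * (f\<^sub>1 z - \<zeta>)) - f\<^sub>2 z) \<le> 2 * (S * (X * exp X))"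
    by (simp add: F_def[abs_def] K_def)
  then show ?thesis using c(1) by blast
qed

section \<open>Pointwise bounds from the Hoelder classes and rescaling\<close>

lemma sup_norm_upper:
  assumes "continuous_on {a..b} \<phi>" "x \<in> {a..b}"
  shows "\<bar>\<phi> x\<bar> \<le> sup_norm {a..b} \<phi>"
  unfolding sup_norm_def
proof (rule cSUP_upper[OF assms(2)])
  have "compact ((\<lambda>x. \<bar>\<phi> x\<bar>) ` {a..b})"
    using assms(1) by (intro compact_continuous_image continuous_intros) auto
  then show "bdd_above ((\<lambda>x. \<bar>\<phi> x\<bar>) ` {a..b})" by (intro bounded_imp_bdd_above compact_imp_bounded)
qed

lemma holder_seminorm_upper:
  assumes "holder_continuous_on \<alpha> UNIV ((deriv ^^ k) \<phi>)" "x \<in> I" "y \<in> I"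
  shows "\<bar>(deriv ^^ k) \<phi> x - (deriv ^^ k) \<phi> y\<bar> \<le> holder_seminorm k \<alpha> I \<phi> * \<bar>x - y\<bar> powr \<alpha>"
proof (cases "x = y")
  case False
  obtain C where C: "\<And>x y. \<bar>(deriv ^^ k) \<phi> x - (deriv ^^ k) \<phi> y\<bar> \<le> C * \<bar>x - y\<bar> powr \<alpha>"
    using assms(1) unfolding holder_continuous_on_def dist_real_def by blast
  let ?r = "\<lambda>(x, y). \<bar>(deriv ^^ k) \<phi> x - (deriv ^^ k) \<phi> y\<bar> / \<bar>x - y\<bar> powr \<alpha>"
  have "?r (x, y) \<le> holder_seminorm k \<alpha> I \<phi>"
    unfolding holder_seminorm_def
  proof (rule cSUP_upper)
    show "bdd_above (?r ` {(x, y). x \<in> I \<and> y \<in> I \<and> x \<noteq> y})"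
      by (rule bdd_aboveI2[of _ _ C]) (use C in \<open>auto simp: divide_le_eq\<close>)
  qed (use assms False in auto)
  then show ?thesis using False by (simp add: divide_le_eq)
qed simp

text \<open>\<open>M\<^sub>1\<close> bounds a sum of three nonnegative terms and hence each of them.
  This is why \<open>M\<^sub>0\<close> enters no constant.\<close>

lemma G1_regularity:
  assumes \<phi>: "\<phi> \<in> G1 \<alpha> m M\<^sub>0 M\<^sub>1 l" and "0 < \<alpha>" "l > 0"
  shows G1_ge: "m \<le> \<phi> x"
    and G1_deriv: "(\<phi> has_real_derivative deriv \<phi> x) (at x)"
    and G1_deriv_continuous: "continuous_on UNIV (deriv \<phi>)"
    and G1_bound: "x \<in> {0..l} \<Longrightarrow> \<bar>\<phi> x\<bar> \<le> M\<^sub>1"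
    and G1_deriv_bound: "x \<in> {0..l} \<Longrightarrow> \<bar>deriv \<phi> x\<bar> \<le> M\<^sub>1"
    and G1_deriv_holder: "x \<in> {0..l} \<Longrightarrow> y \<in> {0..l} \<Longrightarrow> \<bar>deriv \<phi> x - deriv \<phi> y\<bar> \<le> M\<^sub>1 * \<bar>x - y\<bar> powr \<alpha>"
proof -
  show "m \<le> \<phi> x" using \<phi> by (simp add: G1_def G0_def)
  have "\<phi> \<in> C_holder 1 \<alpha>" using \<phi> by (simp add: G1_def)
  then have diff: "\<And>x. \<phi> differentiable (at x)" and hol: "holder_continuous_on \<alpha> UNIV (deriv \<phi>)"
    by (auto simp: C_holder_def)
  show der: "(\<phi> has_real_derivative deriv \<phi> x) (at x)" for x
    using diff DERIV_deriv_iff_real_differentiable by blast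
  show cont': "continuous_on UNIV (deriv \<phi>)"
    by (rule holder_continuous_on_imp_continuous_on[OF \<open>0 < \<alpha>\<close> hol])
  have cont: "continuous_on UNIV \<phi>"
    using der DERIV_isCont continuous_at_imp_continuous_on by blast
  have up: "\<bar>\<phi> x\<bar> \<le> sup_norm {0..l} \<phi>" "\<bar>deriv \<phi> x\<bar> \<le> sup_norm {0..l} (deriv \<phi>)" if "x \<in> {0..l}" for x
    using sup_norm_upper[OF continuous_on_subset[OF cont] that] sup_norm_upper[OF continuous_on_subset[OF cont'] that] by simp_all
  have semi: "\<bar>deriv \<phi> x - deriv \<phi> y\<bar> \<le> holder_seminorm 1 \<alpha> {0..l} \<phi> * \<bar>x - y\<bar> powr \<alpha>"
    if "x \<in> {0..l}" "y \<in> {0..l}" for x y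
    using holder_seminorm_upper[of \<alpha> 1 \<phi> x "{0..l}" y] hol that by simp
  \<comment> \<open>A real supremum gets its sign from an element; the distinct points 0 and
    \<open>l\<close> provide one.\<close>
  have "0 \<le> holder_seminorm 1 \<alpha> {0..l} \<phi> * \<bar>0 - l\<bar> powr \<alpha>"
    using semi[of 0 l] \<open>l > 0\<close> order_trans[OF abs_ge_zero] by auto
  then have "0 \<le> holder_seminorm 1 \<alpha> {0..l} \<phi>"
    using \<open>l > 0\<close> by (simp add: zero_le_mult_iff)
  moreover have "0 \<le> sup_norm {0..l} \<phi>" "0 \<le> sup_norm {0..l} (deriv \<phi>)"
    using up[of 0] \<open>l > 0\<close> order_trans[OF abs_ge_zero] by auto
  moreover have "sup_norm {0..l} \<phi> + sup_norm {0..l} (deriv \<phi>) + holder_seminorm 1 \<alpha> {0..l} \<phi> \<le> M\<^sub>1"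
    using \<phi> by (simp add: G1_def holder_norm_def)
  ultimately have le: "sup_norm {0..l} \<phi> \<le> M\<^sub>1" "sup_norm {0..l} (deriv \<phi>) \<le> M\<^sub>1" "holder_seminorm 1 \<alpha> {0..l} \<phi> \<le> M\<^sub>1"
    by linarith+
  show "\<bar>\<phi> x\<bar> \<le> M\<^sub>1" "\<bar>deriv \<phi> x\<bar> \<le> M\<^sub>1" if "x \<in> {0..l}"
    using up[OF that] le by linarith+
  show "\<bar>deriv \<phi> x - deriv \<phi> y\<bar> \<le> M\<^sub>1 * \<bar>x - y\<bar> powr \<alpha>" if "x \<in> {0..l}" "y \<in> {0..l}"
    using semi[OF that] mult_right_mono[OF le(3), of "\<bar>x - y\<bar> powr \<alpha>"] by simp
qed

lemma conformal_param_disc_map: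
  assumes "conformal_param \<alpha> \<Omega> \<zeta>\<^sub>o \<zeta> f" "C1_holder_domain \<alpha> \<Omega>" "0 < \<alpha>"
  shows "\<exists>f'. disc_map \<alpha> f f'" and "f 0 = \<zeta>\<^sub>o"
proof -
  obtain f' where f': "\<forall>z\<in>cball 0 1. (f has_field_derivative f' z) (at z within cball 0 1)"
      "holder_continuous_on \<alpha> (cball 0 1) f'"
    and f: "f holomorphic_on ball 0 1" "inj_on f (cball 0 1)" "f ` ball 0 1 = \<Omega>" "f 0 = \<zeta>\<^sub>o"
    using assms(1) unfolding conformal_param_def analytic_C1_holder_def by blast
  have "disc_map \<alpha> f f'"
    by unfold_locales (use f f' assms(2,3) in \<open>auto simp: C1_holder_domain_def\<close>)
  then show "\<exists>f'. disc_map \<alpha> f f'" by blast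
  show "f 0 = \<zeta>\<^sub>o" by fact
qed

text \<open>Substituting \<open>\<kappa> * s\<close> multiplies the first derivative by
  \<open>\<kappa>\<close> and its Hoelder constant by
  \<open>\<kappa> * \<kappa> powr \<alpha>\<close>, at most 2 and 4. The differential equation for
  \<open>\<sigma>\<close> expresses that the speed is \<open>1 / (2 * pi * T_op f)\<close> at the
  current arclength \<open>\<kappa> * \<sigma> \<theta>\<close>.\<close>

lemma (in disc_map) normalized_arclength:
  fixes L M m :: real
  assumes T: "T_op f \<in> G1 \<alpha> m M\<^sub>0 M (perimeter f)" and m: "m > 0" and M: "M > 0" and L: "L > 0"
  defines "\<kappa> \<equiv> perimeter f / L"
  defines "\<psi> \<equiv> \<lambda>s. T_op f (\<kappa> * s)" and "\<psi>' \<equiv> \<lambda>s. deriv (T_op f) (\<kappa> * s) * \<kappa>"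
    and "\<sigma> \<equiv> \<lambda>\<theta>. arclen \<theta> / \<kappa>"
  assumes \<kappa>: "\<kappa> \<le> 2" and \<alpha>1: "\<alpha> < 1"
  shows "(\<psi> has_real_derivative \<psi>' x) (at x)"
    and "continuous_on UNIV \<psi>'"
    and "x \<in> {0..L} \<Longrightarrow> m \<le> \<psi> x" and "x \<in> {0..L} \<Longrightarrow> \<psi> x \<le> M" and "x \<in> {0..L} \<Longrightarrow> \<bar>\<psi>' x\<bar> \<le> 2 * M"
    and "x \<in> {0..L} \<Longrightarrow> y \<in> {0..L} \<Longrightarrow> \<bar>\<psi>' x - \<psi>' y\<bar> \<le> 4 * M * \<bar>x - y\<bar> powr \<alpha>"
    and "\<sigma> 0 = 0" and "\<theta> \<in> {0..2 * pi} \<Longrightarrow> \<sigma> \<theta> \<in> {0..L}"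
    and "\<theta> \<in> {0..2 * pi} \<Longrightarrow> (\<sigma> has_real_derivative 1 / (2 * pi * (\<kappa> * \<psi> (\<sigma> \<theta>)))) (at \<theta> within {0..2 * pi})"
    and "\<theta> \<in> {0..2 * pi} \<Longrightarrow> f' (cis \<theta>) \<noteq> 0 \<and> cmod (f' (cis \<theta>)) = 1 / (2 * pi * \<psi> (\<sigma> \<theta>))"
proof -
  note reg = G1_regularity[OF T \<alpha> perimeter_pos]
  have \<kappa>0: "\<kappa> > 0" "\<kappa> * L = perimeter f" using perimeter_pos L by (simp_all add: \<kappa>_def)
  have scale: "\<kappa> * x \<in> {0..perimeter f}" if "x \<in> {0..L}" for x
    using that \<kappa>0 mult_left_mono[of x L \<kappa>] by simp
  have \<sigma>: "\<kappa> * \<sigma> \<theta> = arclen \<theta>" for \<theta> using \<kappa>0 by (simp add: \<sigma>_def)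
  show "(\<psi> has_real_derivative \<psi>' x) (at x)" for x
    unfolding \<psi>_def \<psi>'_def by (rule DERIV_chain2[OF reg(2)]) (auto intro!: derivative_eq_intros)
  show "continuous_on UNIV \<psi>'"
    unfolding \<psi>'_def by (intro continuous_intros continuous_on_compose2[OF reg(3)]) auto
  show "m \<le> \<psi> x" for x using reg(1) by (simp add: \<psi>_def)
  show "\<psi> x \<le> M" if "x \<in> {0..L}" for x using reg(4)[OF scale[OF that]] by (simp add: \<psi>_def)
  show "\<bar>\<psi>' x\<bar> \<le> 2 * M" if "x \<in> {0..L}" for x
    using mult_mono[OF reg(5)[OF scale[OF that]] \<kappa>] \<kappa>0 M by (simp add: \<psi>'_def abs_mult mult.commute)
  show "\<bar>\<psi>' x - \<psi>' y\<bar> \<le> 4 * M * \<bar>x - y\<bar> powr \<alpha>" if xy: "x \<in> {0..L}" "y \<in> {0..L}" for x y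
  proof -
    have "\<bar>\<kappa> * x - \<kappa> * y\<bar> powr \<alpha> = \<kappa> powr \<alpha> * \<bar>x - y\<bar> powr \<alpha>"
      using \<kappa>0 by (simp add: abs_mult powr_mult flip: right_diff_distrib)
    moreover have "\<kappa> powr \<alpha> \<le> 2"
    proof -
      have "\<kappa> powr \<alpha> \<le> 2 powr \<alpha>" using \<kappa> \<kappa>0 \<alpha> by (intro powr_mono2) auto
      also have "\<dots> \<le> 2 powr 1" using \<alpha>1 by (intro powr_mono) auto
      finally show ?thesis by simp
    qed
    ultimately have "M * \<bar>\<kappa> * x - \<kappa> * y\<bar> powr \<alpha> \<le> M * (2 * \<bar>x - y\<bar> powr \<alpha>)"
      using M by (intro mult_left_mono) (auto intro: mult_right_mono)
    with reg(6)[OF scale[OF xy(1)] scale[OF xy(2)]]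
    have "\<bar>deriv (T_op f) (\<kappa> * x) - deriv (T_op f) (\<kappa> * y)\<bar> \<le> M * (2 * \<bar>x - y\<bar> powr \<alpha>)"
      by (rule order_trans)
    then have "\<bar>deriv (T_op f) (\<kappa> * x) - deriv (T_op f) (\<kappa> * y)\<bar> * \<kappa> \<le> M * (2 * \<bar>x - y\<bar> powr \<alpha>) * 2"
      using \<kappa> \<kappa>0 M by (intro mult_mono) auto
    moreover have "\<psi>' x - \<psi>' y = (deriv (T_op f) (\<kappa> * x) - deriv (T_op f) (\<kappa> * y)) * \<kappa>"
      by (simp add: \<psi>'_def left_diff_distrib)
    ultimately show ?thesis using \<kappa>0 by (simp add: abs_mult)
  qed
  show "\<sigma> 0 = 0" by (simp add: \<sigma>_def arclen_0)
  show "\<sigma> \<theta> \<in> {0..L}" if \<theta>: "\<theta> \<in> {0..2 * pi}" for \<theta>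
  proof -
    have "0 \<le> arclen \<theta>" "arclen \<theta> \<le> perimeter f"
      using arclen_strict_mono[of 0 \<theta>] arclen_strict_mono[of \<theta> "2 * pi"] arclen_0 \<theta>
      by (cases "\<theta> = 0"; cases "\<theta> = 2 * pi"; simp add: perimeter_eq)+
    then show ?thesis using \<kappa>0 by (simp add: \<sigma>_def field_simps)
  qed
  have pos: "T_op f s > 0" for s using reg(1)[of s] m by linarith
  have speed: "speed \<theta> > 0 \<and> speed \<theta> = 1 / (2 * pi * \<psi> (\<sigma> \<theta>))" if "\<theta> \<in> {0..2 * pi}" for \<theta>
    using speed_pos[OF pos that] speed_eq[OF pos that] by (simp add: \<psi>_def \<sigma>)
  show "f' (cis \<theta>) \<noteq> 0 \<and> cmod (f' (cis \<theta>)) = 1 / (2 * pi * \<psi> (\<sigma> \<theta>))" if "\<theta> \<in> {0..2 * pi}" for \<theta>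
    using speed[OF that] by (simp add: speed_def)
  show "(\<sigma> has_real_derivative 1 / (2 * pi * (\<kappa> * \<psi> (\<sigma> \<theta>)))) (at \<theta> within {0..2 * pi})"
    if \<theta>: "\<theta> \<in> {0..2 * pi}" for \<theta>
  proof -
    have "(\<sigma> has_real_derivative speed \<theta> / \<kappa>) (at \<theta> within {0..2 * pi})"
      unfolding \<sigma>_def by (rule DERIV_cdivide[OF arclen_deriv[OF \<theta>]])
    moreover have "speed \<theta> / \<kappa> = 1 / (2 * pi * (\<kappa> * \<psi> (\<sigma> \<theta>)))"
      using speed[OF \<theta>] by simp
    ultimately show ?thesis by simp
  qed
qed

theorem theorem3p5:
  fixes \<alpha> m M\<^sub>1 p P :: real
  assumes "0 < \<alpha>" "\<alpha> < 1" "m > 0" "M\<^sub>1 > 0" "0 < p" "p \<le> P"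
  shows "\<exists>K::real. \<forall>(M\<^sub>0::real) \<zeta>\<^sub>o \<Omega>\<^sub>1 \<Omega>\<^sub>2 \<zeta>\<^sub>1 \<zeta>\<^sub>2 f\<^sub>1 f\<^sub>2 L\<^sub>1 L\<^sub>2 L \<phi>\<^sub>1 \<phi>\<^sub>2 \<psi>\<^sub>1 \<psi>\<^sub>2.
    M\<^sub>0 > 0 \<longrightarrow>
    C1_holder_domain \<alpha> \<Omega>\<^sub>1 \<longrightarrow> C1_holder_domain \<alpha> \<Omega>\<^sub>2 \<longrightarrow>
    \<zeta>\<^sub>o \<in> \<Omega>\<^sub>1 \<longrightarrow> \<zeta>\<^sub>o \<in> \<Omega>\<^sub>2 \<longrightarrow>
    \<zeta>\<^sub>1 \<in> frontier \<Omega>\<^sub>1 \<longrightarrow> \<zeta>\<^sub>2 \<in> frontier \<Omega>\<^sub>2 \<longrightarrow>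
    conformal_param \<alpha> \<Omega>\<^sub>1 \<zeta>\<^sub>o \<zeta>\<^sub>1 f\<^sub>1 \<longrightarrow> conformal_param \<alpha> \<Omega>\<^sub>2 \<zeta>\<^sub>o \<zeta>\<^sub>2 f\<^sub>2 \<longrightarrow>
    L\<^sub>1 = perimeter f\<^sub>1 \<longrightarrow> L\<^sub>2 = perimeter f\<^sub>2 \<longrightarrow>
    p \<le> L\<^sub>1 \<longrightarrow> L\<^sub>1 \<le> P \<longrightarrow> p \<le> L\<^sub>2 \<longrightarrow> L\<^sub>2 \<le> P \<longrightarrow>
    \<phi>\<^sub>1 = T_op f\<^sub>1 \<longrightarrow> \<phi>\<^sub>2 = T_op f\<^sub>2 \<longrightarrow>
    L = (L\<^sub>1 + L\<^sub>2) / 2 \<longrightarrow>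
    \<psi>\<^sub>1 = (\<lambda>s. \<phi>\<^sub>1 (L\<^sub>1 / L * s)) \<longrightarrow> \<psi>\<^sub>2 = (\<lambda>s. \<phi>\<^sub>2 (L\<^sub>2 / L * s)) \<longrightarrow>
    \<phi>\<^sub>1 \<in> G1 \<alpha> m M\<^sub>0 M\<^sub>1 L\<^sub>1 \<longrightarrow> \<phi>\<^sub>2 \<in> G1 \<alpha> m M\<^sub>0 M\<^sub>1 L\<^sub>2 \<longrightarrow>
    (\<exists>c::complex. cmod c = 1 \<and>
       C1_norm_circle (\<lambda>z. (\<zeta>\<^sub>o + c * (f\<^sub>1 z - \<zeta>\<^sub>o)) - f\<^sub>2 z)
         \<le> K * ((\<bar>L\<^sub>1 - L\<^sub>2\<bar> / P + sup_norm {0..L} (\<lambda>s. \<psi>\<^sub>1 s - \<psi>\<^sub>2 s) / M\<^sub>1) powr \<alpha>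
                + sup_norm {0..L} (\<lambda>s. deriv \<psi>\<^sub>1 s - deriv \<psi>\<^sub>2 s)))"
proof -
  \<comment> \<open>Since \<open>p \<le> L \<le> P\<close>, the ratios \<open>L\<^sub>1 / L\<close>
    and \<open>L\<^sub>2 / L\<close> are at least \<open>p / P\<close>, and they differ by at most
    \<open>\<bar>L\<^sub>1 - L\<^sub>2\<bar> / p\<close>, which is \<open>P / p\<close> times the
    normalized difference in the claim.\<close>
  define c \<kappa> where "c = P / p" and "\<kappa> = p / P"
  define A where "A = normalized_pair.A\<^sub>2 m M\<^sub>1 c \<kappa> P"
  define C where "C = normalized_pair.C\<^sub>1 \<alpha> m M\<^sub>1 c \<kappa> P"
  define D where "D = 3 * A / m + 8 * exp 2 * C"
  \<comment> \<open>\<open>D\<close> is the factor in the logarithmic error and \<open>1 / m\<close>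
    bounds the derivative of the second map on the circle. The exponential uses
    \<open>3 + 4 * M\<^sub>1\<close>, an a priori bound on the brace in the claim.\<close>
  define K where "K = 2 * (D * exp (D * (3 + 4 * M\<^sub>1)) / m)"
  show ?thesis
  proof (rule exI[of _ K]; intro allI impI)
    fix M\<^sub>0 \<zeta>\<^sub>o \<Omega>\<^sub>1 \<Omega>\<^sub>2 \<zeta>\<^sub>1 \<zeta>\<^sub>2 f\<^sub>1 f\<^sub>2 L\<^sub>1 L\<^sub>2 L \<phi>\<^sub>1 \<phi>\<^sub>2 \<psi>\<^sub>1 \<psi>\<^sub>2
    assume dom: "C1_holder_domain \<alpha> \<Omega>\<^sub>1" "C1_holder_domain \<alpha> \<Omega>\<^sub>2"
      and param: "conformal_param \<alpha> \<Omega>\<^sub>1 \<zeta>\<^sub>o \<zeta>\<^sub>1 f\<^sub>1" "conformal_param \<alpha> \<Omega>\<^sub>2 \<zeta>\<^sub>o \<zeta>\<^sub>2 f\<^sub>2"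
      and per: "L\<^sub>1 = perimeter f\<^sub>1" "L\<^sub>2 = perimeter f\<^sub>2"
      and len: "p \<le> L\<^sub>1" "L\<^sub>1 \<le> P" "p \<le> L\<^sub>2" "L\<^sub>2 \<le> P"
      and \<phi>: "\<phi>\<^sub>1 = T_op f\<^sub>1" "\<phi>\<^sub>2 = T_op f\<^sub>2" and L: "L = (L\<^sub>1 + L\<^sub>2) / 2"
      and \<psi>: "\<psi>\<^sub>1 = (\<lambda>s. \<phi>\<^sub>1 (L\<^sub>1 / L * s))" "\<psi>\<^sub>2 = (\<lambda>s. \<phi>\<^sub>2 (L\<^sub>2 / L * s))"
      and G: "\<phi>\<^sub>1 \<in> G1 \<alpha> m M\<^sub>0 M\<^sub>1 L\<^sub>1" "\<phi>\<^sub>2 \<in> G1 \<alpha> m M\<^sub>0 M\<^sub>1 L\<^sub>2"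
    obtain f\<^sub>1' f\<^sub>2' where f: "disc_map \<alpha> f\<^sub>1 f\<^sub>1'" "disc_map \<alpha> f\<^sub>2 f\<^sub>2'"
      using conformal_param_disc_map(1)[OF param(1) dom(1)] conformal_param_disc_map(1)[OF param(2) dom(2)] assms(1)
      by blast
    have f0: "f\<^sub>1 0 = \<zeta>\<^sub>o" "f\<^sub>2 0 = \<zeta>\<^sub>o"
      using conformal_param_disc_map(2)[OF param(1) dom(1)] conformal_param_disc_map(2)[OF param(2) dom(2)] assms(1)
      by blast+
    define \<kappa>\<^sub>1 \<kappa>\<^sub>2 where "\<kappa>\<^sub>1 = L\<^sub>1 / L" and "\<kappa>\<^sub>2 = L\<^sub>2 / L"
    define \<psi>\<^sub>1' \<psi>\<^sub>2' where "\<psi>\<^sub>1' = (\<lambda>s. deriv \<phi>\<^sub>1 (\<kappa>\<^sub>1 * s) * \<kappa>\<^sub>1)" and "\<psi>\<^sub>2' = (\<lambda>s. deriv \<phi>\<^sub>2 (\<kappa>\<^sub>2 * s) * \<kappa>\<^sub>2)"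
    define \<sigma>\<^sub>1 \<sigma>\<^sub>2 where "\<sigma>\<^sub>1 = (\<lambda>\<theta>. bdry_arclength f\<^sub>1 \<theta> / \<kappa>\<^sub>1)" and "\<sigma>\<^sub>2 = (\<lambda>\<theta>. bdry_arclength f\<^sub>2 \<theta> / \<kappa>\<^sub>2)"
    have L': "p \<le> L" "L \<le> P" "0 < L" using len L assms by auto
    have \<kappa>_le: "\<kappa>\<^sub>1 \<le> 2" "\<kappa>\<^sub>2 \<le> 2" using L L' len assms by (auto simp: \<kappa>\<^sub>1_def \<kappa>\<^sub>2_def field_simps)
    have \<kappa>_ge: "\<kappa> \<le> \<kappa>\<^sub>1" "\<kappa> \<le> \<kappa>\<^sub>2"
      unfolding \<kappa>_def \<kappa>\<^sub>1_def \<kappa>\<^sub>2_def using L' len assms by (intro frac_le; simp)+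
    have at1: "deriv \<phi>\<^sub>1 (\<kappa>\<^sub>1 * s) * \<kappa>\<^sub>1 = \<psi>\<^sub>1' s" "\<phi>\<^sub>1 (\<kappa>\<^sub>1 * s) = \<psi>\<^sub>1 s" "bdry_arclength f\<^sub>1 s / \<kappa>\<^sub>1 = \<sigma>\<^sub>1 s"
      and at2: "deriv \<phi>\<^sub>2 (\<kappa>\<^sub>2 * s) * \<kappa>\<^sub>2 = \<psi>\<^sub>2' s" "\<phi>\<^sub>2 (\<kappa>\<^sub>2 * s) = \<psi>\<^sub>2 s" "bdry_arclength f\<^sub>2 s / \<kappa>\<^sub>2 = \<sigma>\<^sub>2 s" for s
      by (simp_all add: \<psi> \<psi>\<^sub>1'_def \<psi>\<^sub>2'_def \<sigma>\<^sub>1_def \<sigma>\<^sub>2_def \<kappa>\<^sub>1_def \<kappa>\<^sub>2_def)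
    note n1 = disc_map.normalized_arclength[OF f(1) G(1)[unfolded \<phi> per] assms(3,4) L'(3)
        \<kappa>_le(1)[unfolded \<kappa>\<^sub>1_def per] assms(2),
        folded per, folded \<phi>, folded \<kappa>\<^sub>1_def, unfolded at1]
    note n2 = disc_map.normalized_arclength[OF f(2) G(2)[unfolded \<phi> per] assms(3,4) L'(3)
        \<kappa>_le(2)[unfolded \<kappa>\<^sub>2_def per] assms(2),
        folded per, folded \<phi>, folded \<kappa>\<^sub>2_def, unfolded at2]
    have deriv: "deriv \<psi>\<^sub>1 s - deriv \<psi>\<^sub>2 s = \<psi>\<^sub>1' s - \<psi>\<^sub>2' s" for s
      using DERIV_imp_deriv[OF n1(1)] DERIV_imp_deriv[OF n2(1)] by simp
    have cont: "continuous_on {0..L} (\<lambda>s. \<psi>\<^sub>1 s - \<psi>\<^sub>2 s)"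
      by (rule DERIV_continuous_on[OF DERIV_diff[OF has_field_derivative_at_within[OF n1(1)] has_field_derivative_at_within[OF n2(1)]]])
    have cont': "continuous_on {0..L} (\<lambda>s. \<psi>\<^sub>1' s - \<psi>\<^sub>2' s)"
      by (intro continuous_on_diff continuous_on_subset[OF n1(2)] continuous_on_subset[OF n2(2)]) auto
    define \<delta>\<^sub>0 where "\<delta>\<^sub>0 = sup_norm {0..L} (\<lambda>s. \<psi>\<^sub>1 s - \<psi>\<^sub>2 s)"
    define \<delta> where "\<delta> = sup_norm {0..L} (\<lambda>s. \<psi>\<^sub>1' s - \<psi>\<^sub>2' s)"
    define \<eta> where "\<eta> = \<bar>L\<^sub>1 - L\<^sub>2\<bar> / P + \<delta>\<^sub>0 / M\<^sub>1"
    have \<delta>\<^sub>0: "\<bar>\<psi>\<^sub>1 x - \<psi>\<^sub>2 x\<bar> \<le> \<delta>\<^sub>0" if "x \<in> {0..L}" for x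
      unfolding \<delta>\<^sub>0_def by (rule sup_norm_upper[OF cont that])
    have \<delta>: "\<bar>\<psi>\<^sub>1' x - \<psi>\<^sub>2' x\<bar> \<le> \<delta>" if "x \<in> {0..L}" for x
      unfolding \<delta>_def by (rule sup_norm_upper[OF cont' that])
    have nonneg: "0 \<le> \<delta>\<^sub>0" "0 \<le> \<delta>"
      using \<delta>\<^sub>0[of 0] \<delta>[of 0] L'(3) by (auto intro: order_trans[OF abs_ge_zero])
    \<comment> \<open>Together with \<open>\<bar>L\<^sub>1 - L\<^sub>2\<bar> \<le> P\<close> this
      yields the bound 3 on \<eta>.\<close>
    have "\<delta>\<^sub>0 \<le> 2 * M\<^sub>1"
      unfolding \<delta>\<^sub>0_def sup_norm_def
    proof (rule cSUP_least)
      fix x assume x: "x \<in> {0..L}"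
      show "\<bar>\<psi>\<^sub>1 x - \<psi>\<^sub>2 x\<bar> \<le> 2 * M\<^sub>1" using n1(3,4)[OF x] n2(3,4)[OF x] assms(3) by linarith
    qed (use L'(3) in auto)
    then have "\<delta>\<^sub>0 / M\<^sub>1 \<le> 2" using assms(4) by (simp add: field_simps)
    moreover have "\<bar>L\<^sub>1 - L\<^sub>2\<bar> / P \<le> 1" using len assms by (simp add: divide_le_eq)
    moreover have "0 \<le> \<bar>L\<^sub>1 - L\<^sub>2\<bar> / P" "0 \<le> \<delta>\<^sub>0 / M\<^sub>1" using assms nonneg by auto
    ultimately have \<eta>: "0 \<le> \<eta>" "\<eta> \<le> 3" "\<bar>L\<^sub>1 - L\<^sub>2\<bar> / P \<le> \<eta>" "\<delta>\<^sub>0 / M\<^sub>1 \<le> \<eta>"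
      by (auto simp: \<eta>_def)
    have "\<delta> \<le> 4 * M\<^sub>1"
      unfolding \<delta>_def sup_norm_def
    proof (rule cSUP_least)
      fix x assume x: "x \<in> {0..L}"
      show "\<bar>\<psi>\<^sub>1' x - \<psi>\<^sub>2' x\<bar> \<le> 4 * M\<^sub>1" using n1(5)[OF x] n2(5)[OF x] by linarith
    qed (use L'(3) in auto)
    define E where "E = \<eta> powr \<alpha> + \<delta>"
    have "\<eta> powr \<alpha> \<le> 3 powr \<alpha>" using \<eta> assms by (intro powr_mono2) auto
    also have "\<dots> \<le> 3 powr 1" using assms by (intro powr_mono) auto
    finally have E: "0 \<le> E" "E \<le> 3 + 4 * M\<^sub>1"
      using \<open>\<delta> \<le> 4 * M\<^sub>1\<close> nonneg by (auto simp: E_def)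
    interpret normalized_pair \<alpha> m M\<^sub>1 c \<kappa> P L \<eta> \<delta> \<kappa>\<^sub>1 \<kappa>\<^sub>2 "2 * pi" \<psi>\<^sub>1 \<psi>\<^sub>2 \<psi>\<^sub>1' \<psi>\<^sub>2' \<sigma>\<^sub>1 \<sigma>\<^sub>2
    proof
      show "c \<ge> 0" "\<kappa> > 0" using assms by (auto simp: c_def \<kappa>_def)
      have "\<bar>\<kappa>\<^sub>1 - \<kappa>\<^sub>2\<bar> = \<bar>L\<^sub>1 - L\<^sub>2\<bar> / L"
        using L'(3) by (simp add: \<kappa>\<^sub>1_def \<kappa>\<^sub>2_def flip: diff_divide_distrib)
      also have "\<dots> \<le> \<bar>L\<^sub>1 - L\<^sub>2\<bar> / p" using L' assms by (intro divide_left_mono) auto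
      also have "\<dots> = c * (\<bar>L\<^sub>1 - L\<^sub>2\<bar> / P)" using assms by (simp add: c_def)
      also have "\<dots> \<le> c * \<eta>" using \<eta>(3) \<open>c \<ge> 0\<close> by (rule mult_left_mono)
      finally show "\<bar>\<kappa>\<^sub>1 - \<kappa>\<^sub>2\<bar> \<le> c * \<eta>" .
      show "\<bar>\<psi>\<^sub>1 x - \<psi>\<^sub>2 x\<bar> \<le> M\<^sub>1 * \<eta>" if "x \<in> {0..L}" for x
      proof -
        have "\<delta>\<^sub>0 \<le> M\<^sub>1 * \<eta>" using \<eta>(4) assms(4) by (simp add: field_simps)
        then show ?thesis using \<delta>\<^sub>0[OF that] by linarith
      qed
    qed (use assms L' \<kappa>_le \<kappa>_ge \<eta>(1,2) \<delta> n1(3-9) n2(3-9) in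
        \<open>auto intro: has_field_derivative_at_within[OF n1(1)] has_field_derivative_at_within[OF n2(1)]\<close>)
    define B \<Lambda> where "B = 3 * A / m * E" and "\<Lambda> = C * E"
    have A: "0 \<le> A" using A_nonneg by (simp add: A_def)
    have C: "0 \<le> C" using C\<^sub>1_nonneg by (simp add: C_def)
    have polar: "\<exists>\<theta>\<in>{0..2 * pi}. z = cis \<theta>" if "cmod z = 1" for z
      using unit_circle_polar[OF that] by force
    have f1': "f\<^sub>1' (cis \<theta>) \<noteq> 0" "cmod (f\<^sub>1' (cis \<theta>)) = 1 / (2 * pi * \<psi>\<^sub>1 (\<sigma>\<^sub>1 \<theta>))" "0 < \<psi>\<^sub>1 (\<sigma>\<^sub>1 \<theta>)"
      and f2': "f\<^sub>2' (cis \<theta>) \<noteq> 0" "cmod (f\<^sub>2' (cis \<theta>)) = 1 / (2 * pi * \<psi>\<^sub>2 (\<sigma>\<^sub>2 \<theta>))" "m \<le> \<psi>\<^sub>2 (\<sigma>\<^sub>2 \<theta>)"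
      if "\<theta> \<in> {0..2 * pi}" for \<theta>
      using n1(10)[OF that] n2(10)[OF that] n1(3)[OF n1(8)[OF that]] n2(3)[OF n2(8)[OF that]] assms(3) by auto
    have "\<exists>e. cmod e = 1 \<and> C1_norm_circle (\<lambda>z. (\<zeta>\<^sub>o + e * (f\<^sub>1 z - \<zeta>\<^sub>o)) - f\<^sub>2 z)
      \<le> 2 * (1 / m * ((B + 8 * exp 2 * \<Lambda>) * exp (B + 8 * exp 2 * \<Lambda>)))"
    proof (rule disc_maps_close[OF f f0])
      show "f\<^sub>1' z \<noteq> 0" "f\<^sub>2' z \<noteq> 0" if "cmod z = 1" for z
        using polar[OF that] f1'(1) f2'(1) by auto
      show "cmod (f\<^sub>2' z) \<le> 1 / m" if z: "cmod z = 1" for z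
      proof -
        obtain \<theta> where \<theta>: "\<theta> \<in> {0..2 * pi}" "z = cis \<theta>" using polar[OF z] by blast
        have "m \<le> 2 * pi * \<psi>\<^sub>2 (\<sigma>\<^sub>2 \<theta>)"
          using f2'(3)[OF \<theta>(1)] assms(3) pi_gt3 mult_mono[of 1 "2 * pi" m "\<psi>\<^sub>2 (\<sigma>\<^sub>2 \<theta>)"] by simp
        then show ?thesis using f2'(2)[OF \<theta>(1)] \<theta>(2) assms(3) by (simp add: frac_le)
      qed
      fix \<theta> assume \<theta>: "\<theta> \<in> {0..2 * pi}"
      show "v \<theta> = ln (cmod (f\<^sub>1' (cis \<theta>))) - ln (cmod (f\<^sub>2' (cis \<theta>)))"
        using f1'[OF \<theta>] f2'[OF \<theta>] assms(3) by (simp add: v_def ln_div ln_mult)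
      have "\<bar>v \<theta>\<bar> \<le> 3 * A / m * \<eta> powr \<alpha>" using v_bound[OF \<theta>] by (simp add: A_def)
      also have "\<dots> \<le> 3 * A / m * E" using A assms(3) nonneg by (intro mult_left_mono) (auto simp: E_def)
      finally show "\<bar>v \<theta>\<bar> \<le> B" by (simp add: B_def)
    next
      fix a b assume "a \<in> {0..2 * pi}" "b \<in> {0..2 * pi}"
      then show "\<bar>v a - v b\<bar> \<le> \<Lambda> * \<bar>a - b\<bar>" using v_lipschitz[of a b] by (simp add: \<Lambda>_def C_def E_def)
    qed
    moreover have "2 * (1 / m * ((B + 8 * exp 2 * \<Lambda>) * exp (B + 8 * exp 2 * \<Lambda>))) \<le> K * E"
    proof -
      have D: "0 \<le> D" using A C assms(3) by (simp add: D_def)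
      have "B + 8 * exp 2 * \<Lambda> = D * E" by (simp add: B_def \<Lambda>_def D_def algebra_simps)
      \<comment> \<open>One factor \<open>E\<close> is kept as the estimate; the one in the exponent
        is replaced by its a priori bound.\<close>
      moreover have "D * E * exp (D * E) \<le> D * E * exp (D * (3 + 4 * M\<^sub>1))"
        using D E by (intro mult_left_mono) (auto intro: mult_left_mono)
      ultimately show ?thesis using assms(3) by (simp add: K_def field_simps)
    qed
    ultimately have "\<exists>e. cmod e = 1 \<and> C1_norm_circle (\<lambda>z. (\<zeta>\<^sub>o + e * (f\<^sub>1 z - \<zeta>\<^sub>o)) - f\<^sub>2 z) \<le> K * E"
      using order_trans by blast
    then show "\<exists>c. cmod c = 1 \<and> C1_norm_circle (\<lambda>z. (\<zeta>\<^sub>o + c * (f\<^sub>1 z - \<zeta>\<^sub>o)) - f\<^sub>2 z)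
         \<le> K * ((\<bar>L\<^sub>1 - L\<^sub>2\<bar> / P + sup_norm {0..L} (\<lambda>s. \<psi>\<^sub>1 s - \<psi>\<^sub>2 s) / M\<^sub>1) powr \<alpha>
                + sup_norm {0..L} (\<lambda>s. deriv \<psi>\<^sub>1 s - deriv \<psi>\<^sub>2 s))"
      by (simp only: E_def \<eta>_def \<delta>\<^sub>0_def \<delta>_def deriv)
  qed
qed

end
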